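(* Let $P$ be a convex polytope in $\mathbb{R}^D$ with vertices in $\mathbb{Z}^D$, and let $s,d\in\mathbb{N}_0$ be given. There exists a constant $c_{s,d} > 0$ such that, for all sufficiently large $n$, at least $c_{s,d}\cdot 2^{|L(nP)|}$ of the subsets $A \subset L(nP)$ satisfy $$|(L(nP)+L(nP)) \setminus (A+A)| = s \quad\text{and}\quad |(L(nP)-L(nP)) \setminus (A-A)| \ge 2d.$$
   Context: For $S \subset \mathbb{R}^D$, $L(S) = S \cap \mathbb{Z}^D$ denotes the set of lattice points in $S$, and $nS$ denotes the dilation of $S$ by the factor $n$ about the origin. For finite sets $X,Y$, $X+Y=\{x+y: x\in X, y \in Y\}$ and $X-Y=\{x-y: x\in X,y\in Y\}$.
   Formalization: The polytope P is assumed to contain at least two distinct points; for P a single point and d ≥ 1 the claim fails, since L(nP) − L(nP) has only one element and cannot miss 2d differences. *)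

theory Defs
  imports "HOL-Analysis.Analysis"
begin

definition sumset :: "'a::ab_group_add set \<Rightarrow> 'a set \<Rightarrow> 'a set" where
  "sumset X Y = {x + y | x y. x \<in> X \<and> y \<in> Y}"

definition diffset :: "'a::ab_group_add set \<Rightarrow> 'a set \<Rightarrow> 'a set" where
  "diffset X Y = {x - y | x y. x \<in> X \<and> y \<in> Y}"

definition lattice_points :: "(real ^ 'n) set \<Rightarrow> (int ^ 'n) set" where
  "lattice_points S = {z. (\<chi> i. real_of_int (z $ i)) \<in> S}"

definition dilate :: "real \<Rightarrow> (real ^ 'n) set \<Rightarrow> (real ^ 'n) set" where
  "dilate t S = (\<lambda>x. t *\<^sub>R x) ` S"

end

theory Submission
  imports Defs
begin

text \<open>
  Let \<open>L = L(nP)\<close> and call a sum \<open>k \<in> L + L\<close> well represented if many \<open>x \<in> L\<close> have \<open>k - x \<in> L\<close>.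
  Moving weight between two vertices \<open>u, v\<close> of \<open>P\<close> along \<open>u - v\<close> shows that a sum with at most
  \<open>j\<close> representations lies within \<open>O(j)\<close> of some \<open>2nv\<close>, so the number of such sums is polynomial in
  \<open>j\<close>, uniformly in \<open>n\<close>. Hence, for any \<open>T \<subseteq> L\<close> of bounded size, a positive proportion of all subsets
  \<open>A\<close> of \<open>L\<close> satisfies \<open>A \<subseteq> L - T\<close> and \<open>A + A = (L - T) + (L - T)\<close>.
  It remains to find \<open>T\<close> of bounded size such that passing from \<open>L\<close> to \<open>L - T\<close> loses exactly \<open>s\<close>
  sums and at least \<open>2d\<close> differences. For this take vertices \<open>v, w\<close> at maximal distance, measure
  heights by the inner product with \<open>w - v\<close>, and remove the \<open>s\<close> lowest points above \<open>nv\<close> together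
  with suitable slabs near \<open>nv\<close> and \<open>nw\<close>.\<close>

section \<open>Subsets with the full sumset\<close>

text \<open>Orbits of \<sigma> are treated one at a time. On the free points \<open>Q\<close> of an
  orbit the choice \<open>B \<inter> Q = Q\<close> is forbidden, so at most
  \<open>2 ^ card Q - 1\<close> choices remain; the orbit has at most two elements, and each pays a
  factor \<open>7/8\<close>.\<close>

lemma card_sets_avoiding_pairs:
  fixes F G E :: "'a set" and \<sigma> :: "'a \<Rightarrow> 'a"
  assumes "finite G" "finite E" "E \<subseteq> F \<union> G"
    and "\<And>x. x \<in> E \<Longrightarrow> \<sigma> x \<in> E \<and> \<sigma> (\<sigma> x) = x"
  shows "real (card {B. B \<subseteq> G \<and> (\<forall>x\<in>E. \<not> (x \<in> F \<union> B \<and> \<sigma> x \<in> F \<union> B))})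
           \<le> 2 ^ card G * (7/8) ^ card E"
  using assms
proof (induction "card E" arbitrary: E G rule: less_induct)
  case less
  define bad where "bad E G = {B. B \<subseteq> G \<and> (\<forall>x\<in>E. \<not> (x \<in> F \<union> B \<and> \<sigma> x \<in> F \<union> B))}" for E G
  have fin: "finite (bad E' G')" if "finite G'" for E' G'
    by (rule finite_subset[of _ "Pow G'"]) (use that in \<open>auto simp: bad_def\<close>)
  show ?case
  proof (cases "E = {}")
    case True
    then show ?thesis
      using less.prems(1) by (simp add: card_Pow flip: Pow_def)
  next
    case False
    then obtain x where x: "x \<in> E" by blast
    define Q where "Q = {x, \<sigma> x} \<inter> G"
    define E' where "E' = E - {x, \<sigma> x}"
    define G' where "G' = G - Q"
    have finQ: "finite Q" by (simp add: Q_def)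
    have QG: "Q \<subseteq> G" by (simp add: Q_def)
    have cQ: "card Q \<le> 2"
    proof -
      have "card Q \<le> card {x, \<sigma> x}" by (rule card_mono) (auto simp: Q_def)
      also have "\<dots> \<le> 2" by (simp add: card_insert_if)
      finally show ?thesis .
    qed
    have cE: "card E \<le> card E' + 2"
    proof -
      have "card E \<le> card (E' \<union> {x, \<sigma> x})"
        by (rule card_mono) (use less.prems(2) in \<open>auto simp: E'_def\<close>)
      also have "\<dots> \<le> card E' + card {x, \<sigma> x}" by (rule card_Un_le)
      also have "\<dots> \<le> card E' + 2" by (simp add: card_insert_if)
      finally show ?thesis .
    qed
    have lt: "card E' < card E"
      by (rule psubset_card_mono) (use x less.prems(2) in \<open>auto simp: E'_def\<close>)
    have sub: "E' \<subseteq> F \<union> G'" using less.prems(3) by (auto simp: E'_def G'_def Q_def)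
    have inv': "\<sigma> y \<in> E' \<and> \<sigma> (\<sigma> y) = y" if "y \<in> E'" for y
    proof -
      have yE: "y \<in> E" and ne: "y \<noteq> x" "y \<noteq> \<sigma> x" using that by (auto simp: E'_def)
      have s: "\<sigma> y \<in> E" "\<sigma> (\<sigma> y) = y" "\<sigma> (\<sigma> x) = x" using less.prems(4)[OF yE] less.prems(4)[OF x] by auto
      have "\<sigma> y \<noteq> x" using s ne by metis
      moreover have "\<sigma> y \<noteq> \<sigma> x" using s ne by metis
      ultimately show ?thesis using s by (auto simp: E'_def)
    qed
    have IH: "real (card (bad E' G')) \<le> 2 ^ card G' * (7/8) ^ card E'"
      unfolding bad_def
      by (rule less.hyps[OF lt]) (use less.prems sub inv' in \<open>auto simp: E'_def G'_def\<close>)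
    have "card (bad E G) \<le> card ((Pow Q - {Q}) \<times> bad E' G')"
    proof (rule card_inj_on_le[where f = "\<lambda>B. (B \<inter> Q, B - Q)"])
      show "inj_on (\<lambda>B. (B \<inter> Q, B - Q)) (bad E G)"
        by (rule inj_onI) blast
      have "B \<inter> Q \<noteq> Q" if B: "B \<in> bad E G" for B
      proof
        assume "B \<inter> Q = Q"
        moreover have "\<sigma> x \<in> E" using less.prems(4)[OF x] by blast
        ultimately have "x \<in> F \<union> B" "\<sigma> x \<in> F \<union> B"
          using x less.prems(3) by (auto simp: Q_def)
        then show False using B x by (auto simp: bad_def)
      qed
      moreover have "B - Q \<in> bad E' G'" if "B \<in> bad E G" for B
        using that unfolding bad_def E'_def G'_def by auto
      ultimately show "(\<lambda>B. (B \<inter> Q, B - Q)) ` bad E G \<subseteq> (Pow Q - {Q}) \<times> bad E' G'"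
        by auto
      show "finite ((Pow Q - {Q}) \<times> bad E' G')"
        using finQ fin less.prems(1) by (simp add: G'_def)
    qed
    also have "\<dots> = (2 ^ card Q - 1) * card (bad E' G')"
      using finQ by (simp add: card_cartesian_product card_Diff_singleton card_Pow)
    finally have 1: "real (card (bad E G)) \<le> real ((2 ^ card Q - 1) * card (bad E' G'))"
      by (simp only: of_nat_le_iff)
    \<comment> \<open>The worst case is two free points, with ratio \<open>3/4\<close>. This is
      below \<open>49/64 = (7/8) ^ 2\<close>, so one orbit pays for both elements taken out of
      \<open>E\<close>.\<close>
    have 2: "real (2 ^ card Q - 1) \<le> (49/64) * 2 ^ card Q"
    proof -
      consider "card Q = 0" | "card Q = 1" | "card Q = 2" using cQ by linarith
      then show ?thesis by cases auto
    qed
    have "real (card (bad E G)) \<le> ((49/64) * 2 ^ card Q) * (2 ^ card G' * (7/8) ^ card E')"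
      using 1 mult_mono[OF 2 IH] by simp
    also have "\<dots> = 2 ^ (card Q + card G') * (7/8) ^ (card E' + 2)"
      by (simp add: power_add power2_eq_square)
    also have "card Q + card G' = card G"
      using card_Diff_subset[OF finQ QG] card_mono[OF less.prems(1) QG] by (simp add: G'_def)
    also have "2 ^ card G * (7/8) ^ (card E' + 2) \<le> (2 ^ card G * (7/8) ^ card E :: real)"
      by (intro mult_left_mono power_decreasing cE) auto
    finally show ?thesis by (simp add: bad_def)
  qed
qed

text \<open>Representations are ordered and recorded by their first summand, so
  \<open>reps L k\<close> is invariant under the involution sending \<open>x\<close> to
  \<open>k - x\<close>.\<close>

definition reps :: "'a::ab_group_add set \<Rightarrow> 'a \<Rightarrow> 'a set" where
  "reps L k = {x \<in> L. k - x \<in> L}"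

lemma finite_sumset: "finite X \<Longrightarrow> finite Y \<Longrightarrow> finite (sumset X Y)"
  unfolding sumset_def by (rule finite_image_set2) auto

text \<open>The ratio of consecutive terms tends to \<open>7/8\<close>, and
  \<open>15/14 * 7/8 = 15/16\<close>. The tail of this series controls the union bound over well
  represented sums.\<close>

lemma summable_poly_times_geometric: "summable (\<lambda>j. (real j + 1) ^ D * (7/8) ^ j)"
proof -
  have "(\<lambda>j. 1 + inverse (real (Suc j))) \<longlonglongrightarrow> 1"
    by (rule LIMSEQ_inverse_real_of_nat_add)
  then have "(\<lambda>j. (1 + inverse (real (Suc j))) ^ D) \<longlonglongrightarrow> 1 ^ D"
    by (rule tendsto_power)
  then have "\<forall>\<^sub>F j in sequentially. (1 + inverse (real (Suc j))) ^ D < 15/14"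
    by (rule order_tendstoD) simp
  then obtain N where N: "\<And>j. j \<ge> N \<Longrightarrow> (1 + inverse (real (Suc j))) ^ D < 15/14"
    by (auto simp: eventually_sequentially)
  show ?thesis
  proof (rule summable_ratio_test[where c = "15/16" and N = N])
    fix j assume "j \<ge> N"
    have eq: "(real (Suc j) + 1) = (1 + inverse (real (Suc j))) * (real j + 1)"
      by (simp add: field_simps)
    have "(real (Suc j) + 1) ^ D \<le> 15/14 * (real j + 1) ^ D"
      unfolding eq power_mult_distrib using N[OF \<open>j \<ge> N\<close>] by (intro mult_right_mono) auto
    then have "(real (Suc j) + 1) ^ D * (7/8) ^ Suc j \<le> (15/14 * (real j + 1) ^ D) * (7/8) ^ Suc j"
      by (rule mult_right_mono) simp
    then show "norm ((real (Suc j) + 1) ^ D * (7/8) ^ Suc j)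
        \<le> 15/16 * norm ((real j + 1) ^ D * (7/8) ^ j)"
      by (simp add: abs_mult)
  qed simp
qed

text \<open>
  The points occurring in a representation of a poorly represented sum are put into \<open>A\<close> (unless
  they lie in \<open>T\<close>); there are boundedly many of them. All other points outside \<open>T\<close> are
  free, and a union bound over the well represented sums shows that at least half of the
  choices give every sum of \<open>L - T\<close>.\<close>
lemma positive_proportion_full_sumset:
  fixes C :: real and D m :: nat
  assumes C: "C > 0"
  shows "\<exists>c>0. \<forall>(L::'a::ab_group_add set) T. finite L \<longrightarrow>
           (\<forall>j. real (card {k \<in> sumset L L. card (reps L k) \<le> j}) \<le> C * (real j + 1) ^ D) \<longrightarrow>
           T \<subseteq> L \<longrightarrow> card T \<le> m \<longrightarrow>
           c * 2 ^ card L \<le> real (card {A. A \<subseteq> L - T \<and> sumset A A = sumset (L - T) (L - T)})"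
proof -
  \<comment> \<open>Chosen so that, after the factor \<open>C\<close> and the loss
    \<open>(8/7) ^ (2 * m)\<close> caused by \<open>T\<close>, the union bound comes out as one
    half.\<close>
  define \<epsilon> :: real where "\<epsilon> = (7/8) ^ (2 * m) / (2 * C)"
  have \<epsilon>: "\<epsilon> > 0" using C by (simp add: \<epsilon>_def)
  obtain N where N: "\<And>a b. a \<ge> N \<Longrightarrow> norm (\<Sum>j=a..b. (real j + 1) ^ D * (7/8) ^ j) < \<epsilon>"
    using summable_partial_sum_bound[OF summable_poly_times_geometric \<epsilon>] by blast
  \<comment> \<open>Bounds the number of points occurring in poorly represented sums: at most
    \<open>C * (real N + 1) ^ D\<close> sums with at most \<open>N\<close> representations
    each.\<close>
  define M where "M = nat \<lceil>C * (real N + 1) ^ D * real N\<rceil>"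
  \<comment> \<open>The first factor is the share of good choices on the free points, the second the
    cost of prescribing \<open>A\<close> on \<open>W \<union> T\<close>.\<close>
  define c :: real where "c = (1/2) * (1/2) ^ (M + m)"
  have "c * 2 ^ card L \<le> real (card {A. A \<subseteq> L - T \<and> sumset A A = sumset (L - T) (L - T)})"
    if finL: "finite L"
      and gr: "\<And>j. real (card {k \<in> sumset L L. card (reps L k) \<le> j}) \<le> C * (real j + 1) ^ D"
      and TL: "T \<subseteq> L" and cT: "card T \<le> m" for L T :: "'a set"
  proof -
    define Low where "Low = {k \<in> sumset L L. card (reps L k) \<le> N}"
    define W where "W = (\<Union>k\<in>Low. reps L k)"
    define S where "S = sumset (L - T) (L - T)"
    define G where "G = L - (W \<union> T)"
    define F where "F = W - T"
    define E where "E k = {x \<in> L - T. k - x \<in> L - T}" for k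
    define bad where "bad k = {B. B \<subseteq> G \<and> (\<forall>x\<in>E k. \<not> (x \<in> F \<union> B \<and> k - x \<in> F \<union> B))}" for k
    define K where "K = S - Low"
    have finT: "finite T" using finL TL by (rule rev_finite_subset)
    have finS: "finite S" unfolding S_def using finL by (intro finite_sumset) auto
    have finK: "finite K" using finS by (simp add: K_def)
    have finG: "finite G" using finL by (simp add: G_def)
    have finLow: "finite Low" using finite_sumset[OF finL finL] by (simp add: Low_def)
    have WL: "W \<subseteq> L" by (auto simp: W_def reps_def)
    have SLL: "S \<subseteq> sumset L L" by (auto simp: S_def sumset_def)
    have finr: "finite (reps L k)" for k using finL by (simp add: reps_def)
    have "card W \<le> (\<Sum>k\<in>Low. card (reps L k))"
      unfolding W_def by (rule card_UN_le[OF finLow])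
    also have "\<dots> \<le> (\<Sum>k\<in>Low. N)" by (rule sum_mono) (simp add: Low_def)
    finally have "real (card W) \<le> real (card Low) * real N" by (simp flip: of_nat_mult)
    also have "\<dots> \<le> C * (real N + 1) ^ D * real N"
      using gr[of N] by (intro mult_right_mono) (simp_all add: Low_def)
    finally have cW: "card W \<le> M" unfolding M_def by linarith
    have "card L \<le> card (G \<union> (W \<union> T))"
      by (rule card_mono) (use finG finT finL WL in \<open>auto simp: G_def intro: finite_subset\<close>)
    also have "\<dots> \<le> card G + card (W \<union> T)" by (rule card_Un_le)
    also have "\<dots> \<le> card G + (card W + card T)" using card_Un_le[of W T] by simp
    finally have cL: "card L \<le> card G + (M + m)" using cW cT by simp
    have finbad: "finite (bad k)" for k
      by (rule finite_subset[of _ "Pow G"]) (use finG in \<open>auto simp: bad_def\<close>)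
    have bad_le: "real (card (bad k)) \<le> 2 ^ card G / (7/8) ^ (2 * m) * (7/8) ^ card (reps L k)" for k
    proof -
      \<comment> \<open>Deleting \<open>T\<close> destroys at most \<open>2 * card T\<close>
        representations: those with \<open>x \<in> T\<close> and those with
        \<open>k - x \<in> T\<close>.\<close>
      have "x \<in> (\<lambda>x. k - x) ` T" if "k - x \<in> T" for x
        using that by (intro image_eqI[of _ _ "k - x"]) auto
      then have "reps L k \<subseteq> E k \<union> (T \<union> (\<lambda>x. k - x) ` T)"
        by (auto simp: reps_def E_def)
      then have "card (reps L k) \<le> card (E k \<union> (T \<union> (\<lambda>x. k - x) ` T))"
        by (rule card_mono[rotated]) (use finL finT in \<open>simp add: E_def\<close>)
      also have "\<dots> \<le> card (E k) + (card T + card ((\<lambda>x. k - x) ` T))"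
        by (meson add_left_mono card_Un_le le_trans)
      also have "\<dots> \<le> card (E k) + 2 * m"
        using card_image_le[OF finT, of "\<lambda>x. k - x"] cT by linarith
      finally have r: "card (reps L k) \<le> card (E k) + 2 * m" .
      have "real (card (bad k)) \<le> 2 ^ card G * (7/8) ^ card (E k)"
        unfolding bad_def
        by (rule card_sets_avoiding_pairs)
           (use finG finL WL in \<open>auto simp: E_def F_def G_def\<close>)
      also have "(7/8) ^ card (E k) = (7/8::real) ^ (card (E k) + 2 * m) / (7/8) ^ (2 * m)"
        by (simp add: power_add)
      also have "\<dots> \<le> (7/8::real) ^ card (reps L k) / (7/8) ^ (2 * m)"
        by (intro divide_right_mono power_decreasing r) auto
      finally show ?thesis by (simp add: mult_left_mono)
    qed
    \<comment> \<open>Grouping by the exact number \<open>j\<close> of representations. Outside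
      \<open>Low\<close> it exceeds \<open>N\<close>, so only the tail of the series enters.\<close>
    have "(\<Sum>k\<in>K. (7/8::real) ^ card (reps L k))
        = (\<Sum>j=N..card L. \<Sum>k\<in>{k\<in>K. card (reps L k) = j}. (7/8) ^ card (reps L k))"
      by (rule sum.group[symmetric, OF finK])
         (use SLL in \<open>auto simp: K_def Low_def reps_def intro!: card_mono finL\<close>)
    also have "\<dots> \<le> (\<Sum>j=N..card L. C * ((real j + 1) ^ D * (7/8) ^ j))"
    proof (rule sum_mono)
      fix j
      have "(\<Sum>k\<in>{k\<in>K. card (reps L k) = j}. (7/8::real) ^ card (reps L k))
          = real (card {k\<in>K. card (reps L k) = j}) * (7/8) ^ j" by simp
      also have "\<dots> \<le> (C * (real j + 1) ^ D) * (7/8) ^ j"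
      proof (rule mult_right_mono)
        have "card {k\<in>K. card (reps L k) = j} \<le> card {k \<in> sumset L L. card (reps L k) \<le> j}"
          by (rule card_mono) (use SLL finite_sumset[OF finL finL] in \<open>auto simp: K_def\<close>)
        then show "real (card {k\<in>K. card (reps L k) = j}) \<le> C * (real j + 1) ^ D"
          using gr[of j] by linarith
      qed simp
      finally show "(\<Sum>k\<in>{k\<in>K. card (reps L k) = j}. (7/8::real) ^ card (reps L k))
          \<le> C * ((real j + 1) ^ D * (7/8) ^ j)" by simp
    qed
    also have "\<dots> = C * (\<Sum>j=N..card L. (real j + 1) ^ D * (7/8) ^ j)"
      by (simp add: sum_distrib_left)
    also have "\<dots> \<le> C * \<epsilon>"
      using N[of N "card L"] C by (intro mult_left_mono) auto
    finally have small: "(\<Sum>k\<in>K. (7/8::real) ^ card (reps L k)) \<le> (7/8) ^ (2 * m) / 2"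
      using C by (simp add: \<epsilon>_def)
    have "real (card (\<Union>k\<in>K. bad k)) \<le> (\<Sum>k\<in>K. real (card (bad k)))"
      using card_UN_le[OF finK, of bad] by (simp flip: of_nat_sum)
    also have "\<dots> \<le> (\<Sum>k\<in>K. 2 ^ card G / (7/8) ^ (2 * m) * (7/8) ^ card (reps L k))"
      by (intro sum_mono bad_le)
    also have "\<dots> = 2 ^ card G / (7/8) ^ (2 * m) * (\<Sum>k\<in>K. (7/8) ^ card (reps L k))"
      by (simp add: sum_distrib_left)
    also have "\<dots> \<le> 2 ^ card G / (7/8) ^ (2 * m) * ((7/8) ^ (2 * m) / 2)"
      by (intro mult_left_mono small) auto
    finally have half: "real (card (\<Union>k\<in>K. bad k)) \<le> 2 ^ card G / 2" by simp
    define Good where "Good = Pow G - (\<Union>k\<in>K. bad k)"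
    have "card (Pow G) \<le> card Good + card (\<Union>k\<in>K. bad k)"
      unfolding Good_def by (metis diff_card_le_card_Diff finK finbad finite_UN le_diff_conv)
    then have "real (card (Pow G)) \<le> real (card Good) + real (card (\<Union>k\<in>K. bad k))"
      by linarith
    then have good: "2 ^ card G / 2 \<le> real (card Good)"
      using half finG by (simp add: card_Pow)
    have "card Good \<le> card {A. A \<subseteq> L - T \<and> sumset A A = S}"
    proof (rule card_inj_on_le[where f = "\<lambda>B. F \<union> B"])
      show "inj_on (\<lambda>B. F \<union> B) Good"
        by (rule inj_onI) (auto simp: Good_def F_def G_def)
      show "finite {A. A \<subseteq> L - T \<and> sumset A A = S}"
        by (rule finite_subset[of _ "Pow L"]) (use finL in auto)
      show "(\<lambda>B. F \<union> B) ` Good \<subseteq> {A. A \<subseteq> L - T \<and> sumset A A = S}"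
      proof (clarify, intro conjI)
        fix B assume B: "B \<in> Good"
        show sub: "F \<union> B \<subseteq> L - T" using B WL by (auto simp: Good_def F_def G_def)
        show "sumset (F \<union> B) (F \<union> B) = S"
        proof
          show "sumset (F \<union> B) (F \<union> B) \<subseteq> S" using sub unfolding S_def sumset_def by blast
          show "S \<subseteq> sumset (F \<union> B) (F \<union> B)"
          proof
            fix k assume k: "k \<in> S"
            show "k \<in> sumset (F \<union> B) (F \<union> B)"
            proof (cases "k \<in> Low")
              case True
              obtain x y where xy: "k = x + y" "x \<in> L - T" "y \<in> L - T"
                using k by (auto simp: S_def sumset_def)
              then have "x \<in> reps L k" "y \<in> reps L k" by (auto simp: reps_def)
              with xy True have "x \<in> F" "y \<in> F" by (auto simp: F_def W_def)
              with xy show ?thesis by (auto simp: sumset_def)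
            next
              case False
              then have "B \<notin> bad k" using k B by (auto simp: K_def Good_def)
              moreover have "B \<subseteq> G" using B by (auto simp: Good_def)
              ultimately obtain x where "x \<in> F \<union> B" "k - x \<in> F \<union> B"
                by (auto simp: bad_def)
              moreover have "k = x + (k - x)" by simp
              ultimately show ?thesis unfolding sumset_def by blast
            qed
          qed
        qed
      qed
    qed
    then have "real (card Good) \<le> real (card {A. A \<subseteq> L - T \<and> sumset A A = S})" by simp
    moreover have "c * 2 ^ card L \<le> 2 ^ card G / 2"
    proof -
      have "(2::real) ^ card L \<le> 2 ^ (card G + (M + m))" by (intro power_increasing cL) simp
      then have "c * 2 ^ card L \<le> c * 2 ^ (card G + (M + m))"
        by (intro mult_left_mono) (auto simp: c_def)
      also have "\<dots> = 2 ^ card G / 2"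
        by (simp add: c_def power_add power_one_over)
      finally show ?thesis .
    qed
    ultimately show ?thesis using good unfolding S_def by linarith
  qed
  moreover have "c > 0" by (simp add: c_def)
  ultimately show ?thesis by blast
qed

section \<open>Lattice points in dilated hulls\<close>

definition emb :: "int ^ 'n \<Rightarrow> real ^ 'n" where
  "emb z = (\<chi> i. real_of_int (z $ i))"

lemma emb_nth [simp]: "emb z $ i = real_of_int (z $ i)"
  by (simp add: emb_def)

lemma emb_add: "emb (x + y) = emb x + emb y"
  and emb_diff: "emb (x - y) = emb x - emb y"
  and emb_smult: "emb (k *s x) = real_of_int k *\<^sub>R emb x"
  by (simp_all add: vec_eq_iff)

lemma emb_sum: "emb (\<Sum>u\<in>U. f u) = (\<Sum>u\<in>U. emb (f u))"
  by (simp add: vec_eq_iff)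

lemma emb_eq_iff [simp]: "emb x = emb y \<longleftrightarrow> x = y"
  by (simp add: vec_eq_iff)

lemma inj_emb: "inj emb"
  by (simp add: inj_def)

lemma integral_vec: "(\<forall>i. x $ i \<in> \<int>) \<Longrightarrow> \<exists>z. emb z = x"
  by (intro exI[of _ "\<chi> i. \<lfloor>x $ i\<rfloor>"]) (simp add: vec_eq_iff)

text \<open>Barycentric coordinates scaled to total weight \<open>n\<close>: moving an integral
  amount of weight between vertices moves the point by a lattice vector. They need not be unique,
  hence a relation.\<close>

definition coords :: "(int ^ 'n) set \<Rightarrow> nat \<Rightarrow> (int ^ 'n \<Rightarrow> real) \<Rightarrow> int ^ 'n \<Rightarrow> bool" where
  "coords V n c z \<longleftrightarrow>
     (\<forall>u\<in>V. 0 \<le> c u) \<and> sum c V = real n \<and> emb z = (\<Sum>u\<in>V. c u *\<^sub>R emb u)"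

definition hull_points :: "(int ^ 'n) set \<Rightarrow> nat \<Rightarrow> (int ^ 'n) set" where
  "hull_points V n = {z. \<exists>c. coords V n c z}"

text \<open>Scaling barycentric coordinates by \<open>n\<close> or its inverse carries the real
  dilate over to the integral description used from here on.\<close>

lemma lattice_points_dilate_hull:
  fixes V :: "(int ^ 'n) set"
  assumes V: "finite V" and n: "n > 0"
  shows "lattice_points (dilate (real n) (convex hull (emb ` V))) = hull_points V n"
proof (rule set_eqI)
  fix z :: "int ^ 'n"
  have hull: "p \<in> convex hull (emb ` V) \<longleftrightarrow>
      (\<exists>c. (\<forall>u\<in>V. 0 \<le> c u) \<and> sum c V = 1 \<and> (\<Sum>u\<in>V. c u *\<^sub>R emb u) = p)" for p
  proof -
    have inj: "inj_on emb V" using inj_emb by (rule inj_on_subset) simp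
    have "p \<in> convex hull (emb ` V) \<longleftrightarrow>
      (\<exists>c. (\<forall>u\<in>V. 0 \<le> c (emb u)) \<and> (\<Sum>u\<in>V. c (emb u)) = 1 \<and> (\<Sum>u\<in>V. c (emb u) *\<^sub>R emb u) = p)"
      using V by (simp add: convex_hull_finite sum.reindex[OF inj] o_def)
    also have "\<dots> \<longleftrightarrow> (\<exists>c. (\<forall>u\<in>V. 0 \<le> c u) \<and> sum c V = 1 \<and> (\<Sum>u\<in>V. c u *\<^sub>R emb u) = p)"
    proof
      assume "\<exists>c. (\<forall>u\<in>V. 0 \<le> c u) \<and> sum c V = 1 \<and> (\<Sum>u\<in>V. c u *\<^sub>R emb u) = p"
      then obtain c where "(\<forall>u\<in>V. 0 \<le> c u) \<and> sum c V = 1 \<and> (\<Sum>u\<in>V. c u *\<^sub>R emb u) = p" by blast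
      then show "\<exists>c. (\<forall>u\<in>V. 0 \<le> c (emb u)) \<and> (\<Sum>u\<in>V. c (emb u)) = 1 \<and> (\<Sum>u\<in>V. c (emb u) *\<^sub>R emb u) = p"
        by (intro exI[of _ "\<lambda>x. c (inv emb x)"]) (simp add: inv_f_f[OF inj_emb])
    qed (rule exE, assumption, rule exI, assumption)
    finally show ?thesis .
  qed
  have "z \<in> lattice_points (dilate (real n) (convex hull (emb ` V))) \<longleftrightarrow>
      (\<exists>p \<in> convex hull (emb ` V). emb z = real n *\<^sub>R p)"
    unfolding lattice_points_def dilate_def by (auto simp flip: emb_def)
  also have "\<dots> \<longleftrightarrow> (\<exists>c. coords V n c z)"
  proof
    assume "\<exists>p \<in> convex hull (emb ` V). emb z = real n *\<^sub>R p"
    then obtain c where "\<forall>u\<in>V. 0 \<le> c u" "sum c V = 1" "emb z = real n *\<^sub>R (\<Sum>u\<in>V. c u *\<^sub>R emb u)"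
      by (auto simp: hull)
    then have "coords V n (\<lambda>u. real n * c u) z"
      by (simp add: coords_def scaleR_sum_right flip: sum_distrib_left)
    then show "\<exists>c. coords V n c z" by blast
  next
    assume "\<exists>c. coords V n c z"
    then obtain c where c: "coords V n c z" by blast
    have "(\<Sum>u\<in>V. (c u / real n) *\<^sub>R emb u) = (1 / real n) *\<^sub>R emb z"
      using c by (simp add: coords_def scaleR_sum_right)
    moreover have "(\<Sum>u\<in>V. c u / real n) = 1"
      using c n by (simp add: coords_def flip: sum_divide_distrib)
    moreover have "\<forall>u\<in>V. 0 \<le> c u / real n" using c by (simp add: coords_def)
    ultimately have "(1 / real n) *\<^sub>R emb z \<in> convex hull (emb ` V)"
      unfolding hull by (intro exI[of _ "\<lambda>u. c u / real n"]) auto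
    then show "\<exists>p \<in> convex hull (emb ` V). emb z = real n *\<^sub>R p"
      using n by (intro bexI[of _ "(1 / real n) *\<^sub>R emb z"]) auto
  qed
  finally show "z \<in> lattice_points (dilate (real n) (convex hull (emb ` V))) \<longleftrightarrow> z \<in> hull_points V n"
    by (simp add: hull_points_def)
qed

lemma coords_diff_vertex:
  assumes "coords V n c z"
  shows "emb z - real n *\<^sub>R emb v = (\<Sum>u\<in>V. c u *\<^sub>R (emb u - emb v))"
  using assms by (simp add: coords_def scaleR_diff_right sum_subtractf flip: scaleR_sum_left)

text \<open>The weight at \<open>v\<close> is whatever remains of \<open>n\<close>, so only the
  weights off \<open>v\<close> have to be supplied.\<close>

lemma coordsI:
  assumes "finite V" "v \<in> V" "\<And>u. u \<in> V - {v} \<Longrightarrow> 0 \<le> c u" "sum c (V - {v}) \<le> real n"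
    and "emb z = real n *\<^sub>R emb v + (\<Sum>u\<in>V - {v}. c u *\<^sub>R (emb u - emb v))"
  shows "z \<in> hull_points V n"
proof -
  define b where "b u = (if u = v then real n - sum c (V - {v}) else c u)" for u
  have eq: "sum b (V - {v}) = sum c (V - {v})" by (rule sum.cong) (auto simp: b_def)
  have eq': "(\<Sum>u\<in>V - {v}. b u *\<^sub>R emb u) = (\<Sum>u\<in>V - {v}. c u *\<^sub>R emb u)"
    by (rule sum.cong) (auto simp: b_def)
  have "coords V n b z"
    unfolding coords_def sum.remove[OF assms(1,2)] eq eq'
    using assms(3,4,5)
    by (auto simp: b_def scaleR_diff_right scaleR_diff_left sum_subtractf scaleR_sum_left)
  then show ?thesis by (auto simp: hull_points_def)
qed

text \<open>Weight \<open>i\<close> moves from \<open>v\<close> to \<open>u\<close>. The total stays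
  \<open>n\<close>, and nothing becomes negative because \<open>v\<close> carries at least
  \<open>i\<close>.\<close>

lemma hull_points_shift:
  assumes V: "finite V" "u \<in> V" "v \<in> V" and c: "coords V n c z" and i: "real i \<le> c v"
  shows "z + int i *s (u - v) \<in> hull_points V n"
proof (cases "u = v")
  case True
  then show ?thesis using c by (auto simp: hull_points_def)
next
  case False
  define b where "b x = (if x = u then c x + real i else c x)" for x
  have uv: "u \<in> V - {v}" "finite (V - {v})" using V False by auto
  have b_sum: "sum b (V - {v}) = sum c (V - {v}) + real i"
    unfolding sum.remove[OF uv(2,1)] by (auto simp: b_def intro!: sum.cong)
  have "real n = c v + sum c (V - {v})" using c sum.remove[OF V(1,3), of c] by (simp add: coords_def)
  then have "sum b (V - {v}) \<le> real n" using i b_sum by linarith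
  moreover have "emb (z + int i *s (u - v)) = real n *\<^sub>R emb v + (\<Sum>x\<in>V - {v}. b x *\<^sub>R (emb x - emb v))"
  proof -
    have "(\<Sum>x\<in>V - {v}. b x *\<^sub>R (emb x - emb v))
        = (\<Sum>x\<in>V - {v}. c x *\<^sub>R (emb x - emb v)) + real i *\<^sub>R (emb u - emb v)"
      unfolding sum.remove[OF uv(2,1)]
      by (auto simp: b_def scaleR_add_left intro!: sum.cong)
    moreover have "emb z - real n *\<^sub>R emb v = (\<Sum>x\<in>V - {v}. c x *\<^sub>R (emb x - emb v))"
      using coords_diff_vertex[OF c, of v] sum.remove[OF V(1,3), of "\<lambda>x. c x *\<^sub>R (emb x - emb v)"] by simp
    ultimately show ?thesis by (simp add: emb_add emb_smult emb_diff algebra_simps)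
  qed
  ultimately show ?thesis
    by (intro coordsI[OF V(1,3), of b]) (use c in \<open>auto simp: b_def coords_def\<close>)
qed

text \<open>For \<open>i = 0, ..., j\<close>, moving weight \<open>i\<close> from \<open>v\<close>
  to \<open>u\<close> in \<open>x\<close> and back from \<open>u\<close> to \<open>v\<close> in
  \<open>y\<close> keeps the sum. The \<open>j + 1\<close> representations are distinct since
  \<open>u \<noteq> v\<close>.\<close>

lemma many_reps:
  assumes V: "finite V" "u \<in> V" "v \<in> V" "u \<noteq> v"
    and x: "coords V n c x" "real j \<le> c v" and y: "coords V n b y" "real j \<le> b u"
    and fin: "finite (hull_points V n)"
  shows "j < card (reps (hull_points V n) (x + y))"
proof -
  have "card ((\<lambda>i. x + int i *s (u - v)) ` {..j}) \<le> card (reps (hull_points V n) (x + y))"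
  proof (rule card_mono)
    show "finite (reps (hull_points V n) (x + y))" using fin by (simp add: reps_def)
    have "x + int i *s (u - v) \<in> reps (hull_points V n) (x + y)" if "i \<le> j" for i
    proof -
      have "x + y - (x + int i *s (u - v)) = y + int i *s (v - u)"
        by (simp add: vec_eq_iff algebra_simps)
      moreover have "x + int i *s (u - v) \<in> hull_points V n"
        by (rule hull_points_shift[OF V(1-3) x(1)]) (use that x(2) in simp)
      moreover have "y + int i *s (v - u) \<in> hull_points V n"
        by (rule hull_points_shift[OF V(1,3,2) y(1)]) (use that y(2) in simp)
      ultimately show ?thesis unfolding reps_def by (metis (mono_tags, lifting) mem_Collect_eq)
    qed
    then show "(\<lambda>i. x + int i *s (u - v)) ` {..j} \<subseteq> reps (hull_points V n) (x + y)" by auto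
  qed
  moreover have "inj_on (\<lambda>i. x + int i *s (u - v)) {..j}"
  proof (rule inj_onI)
    fix a b assume eq: "x + int a *s (u - v) = x + int b *s (u - v)"
    obtain i where i: "(u - v) $ i \<noteq> 0" using V(4) by (auto simp: vec_eq_iff)
    have "int a * (u - v) $ i = int b * (u - v) $ i" 
      using arg_cong[OF eq, of "\<lambda>z. z $ i"] by (simp add: right_diff_distrib del: mult_cancel_right)
    then have "int a = int b" using i by (metis mult_right_cancel)
    then show "a = b" by simp
  qed
  ultimately show ?thesis by (simp add: card_image)
qed

section \<open>Boxes around vertices and the number of poorly represented sums\<close>

definition int_box :: "nat \<Rightarrow> (int ^ 'n) set" where
  "int_box b = {z. \<forall>i. \<bar>z $ i\<bar> \<le> int b}"

lemma finite_int_box: "finite (int_box b :: (int ^ 'n) set)"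
  and card_int_box: "card (int_box b :: (int ^ 'n) set) \<le> (2 * b + 1) ^ CARD('n)"
proof -
  let ?F = "UNIV \<rightarrow>\<^sub>E {- int b..int b} :: ('n \<Rightarrow> int) set"
  have inj: "inj_on vec_nth (int_box b :: (int ^ 'n) set)" by (rule inj_onI) (simp add: vec_eq_iff)
  have sub: "vec_nth ` (int_box b :: (int ^ 'n) set) \<subseteq> ?F" 
  proof (rule image_subsetI)
    fix z :: "int ^ 'n" assume "z \<in> int_box b"
    then have "- int b \<le> z $ i \<and> z $ i \<le> int b" for i
      unfolding int_box_def by (simp add: abs_le_iff minus_le_iff)
    then show "vec_nth z \<in> ?F" by auto
  qed
  have fin: "finite ?F" by (intro finite_PiE) auto
  show "finite (int_box b :: (int ^ 'n) set)" by (rule inj_on_finite[OF inj sub fin])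
  have "card (int_box b :: (int ^ 'n) set) \<le> card ?F" by (rule card_inj_on_le[OF inj sub fin])
  also have "\<dots> = (2 * b + 1) ^ CARD('n)" by (simp add: card_PiE) (simp add: nat_add_distrib nat_mult_distrib)
  finally show "card (int_box b :: (int ^ 'n) set) \<le> (2 * b + 1) ^ CARD('n)" .
qed

text \<open>A crude common bound for the coordinates of all vertex differences; a sum dominates each
  of its terms and, unlike a maximum, also makes sense for empty \<open>V\<close>.\<close>

definition spread :: "(int ^ 'n) set \<Rightarrow> nat" where
  "spread V = (\<Sum>u\<in>V. \<Sum>v\<in>V. \<Sum>i\<in>UNIV. nat \<bar>(u - v) $ i\<bar>)"

lemma spread_bound:
  assumes "finite V" "u \<in> V" "v \<in> V"
  shows "\<bar>(u - v) $ i\<bar> \<le> int (spread V)"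
proof -
  have "nat \<bar>(u - v) $ i\<bar> \<le> (\<Sum>i\<in>UNIV. nat \<bar>(u - v) $ i\<bar>)"
    by (rule member_le_sum) auto
  also have "\<dots> \<le> (\<Sum>v\<in>V. \<Sum>i\<in>UNIV. nat \<bar>(u - v) $ i\<bar>)"
    by (rule member_le_sum[of v V "\<lambda>v. \<Sum>i\<in>UNIV. nat \<bar>(u - v) $ i\<bar>"]) (use assms in auto)
  also have "\<dots> \<le> spread V" unfolding spread_def
    by (rule member_le_sum[of u V "\<lambda>u. \<Sum>v\<in>V. \<Sum>i\<in>UNIV. nat \<bar>(u - v) $ i\<bar>"]) (use assms in auto)
  finally show ?thesis by linarith
qed

text \<open>The summand at \<open>v\<close> vanishes whatever \<open>c v\<close> is, so only the
  weight off \<open>v\<close> determines how far the point lies from the vertex.\<close>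

lemma int_box_of_coeffs:
  assumes V: "finite V" "v \<in> V" and c: "\<And>u. u \<in> V - {v} \<Longrightarrow> 0 \<le> c u" "sum c (V - {v}) \<le> real b"
    and z: "emb z = (\<Sum>u\<in>V. c u *\<^sub>R (emb u - emb v))"
  shows "z \<in> int_box (b * spread V)"
proof -
  have "\<bar>z $ i\<bar> \<le> int (b * spread V)" for i
  proof -
    have "real_of_int (z $ i) = (\<Sum>u\<in>V. c u * real_of_int ((u - v) $ i))"
      using arg_cong[OF z, of "\<lambda>x. x $ i"] by simp
    also have "\<dots> = (\<Sum>u\<in>V - {v}. c u * real_of_int ((u - v) $ i))"
      by (simp add: sum.remove[OF V])
    finally have "\<bar>real_of_int (z $ i)\<bar> \<le> (\<Sum>u\<in>V - {v}. \<bar>c u * real_of_int ((u - v) $ i)\<bar>)"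
      by (simp add: sum_abs)
    also have "\<dots> \<le> (\<Sum>u\<in>V - {v}. c u * real (spread V))"
    proof (rule sum_mono)
      fix u assume u: "u \<in> V - {v}"
      have "\<bar>real_of_int ((u - v) $ i)\<bar> \<le> real (spread V)"
        using spread_bound[OF V(1) _ V(2), of u i] u by (simp flip: of_int_abs)
      then show "\<bar>c u * real_of_int ((u - v) $ i)\<bar> \<le> c u * real (spread V)"
        using c(1)[OF u] by (simp add: abs_mult mult_left_mono)
    qed
    also have "\<dots> = sum c (V - {v}) * real (spread V)" by (simp add: sum_distrib_right)
    also have "\<dots> \<le> real b * real (spread V)" by (intro mult_right_mono c(2)) simp
    finally show ?thesis by (simp flip: of_nat_mult)
  qed
  then show ?thesis by (simp add: int_box_def)
qed

lemma finite_hull_points: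
  assumes V: "finite V"
  shows "finite (hull_points V n)"
proof (cases "V = {}")
  case True
  have "hull_points V n \<subseteq> {0}" using True by (auto simp: hull_points_def coords_def vec_eq_iff)
  then show ?thesis by (rule finite_subset) simp
next
  case False
  then obtain v where v: "v \<in> V" by blast
  have "hull_points V n \<subseteq> (\<lambda>z. z + int n *s v) ` int_box (n * spread V)"
  proof
    fix z assume "z \<in> hull_points V n"
    then obtain c where c: "coords V n c z" by (auto simp: hull_points_def)
    have "z - int n *s v \<in> int_box (n * spread V)"
    proof (rule int_box_of_coeffs[OF V v, of c])
      show "sum c (V - {v}) \<le> real n"
        using c v sum.remove[OF V v, of c] by (auto simp: coords_def)
      show "emb (z - int n *s v) = (\<Sum>u\<in>V. c u *\<^sub>R (emb u - emb v))"
        using coords_diff_vertex[OF c, of v] by (simp add: emb_diff emb_smult)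
    qed (use c in \<open>auto simp: coords_def\<close>)
    then show "z \<in> (\<lambda>z. z + int n *s v) ` int_box (n * spread V)"
      by (intro image_eqI[of _ _ "z - int n *s v"]) auto
  qed
  then show ?thesis by (rule finite_subset) (simp add: finite_int_box)
qed

lemma sum_le_off_vertex:
  assumes "finite V" "v \<in> V" "\<And>u. u \<in> V - {v} \<Longrightarrow> c u \<le> real j"
  shows "sum c (V - {v}) \<le> real (card V * j)"
proof -
  have "sum c (V - {v}) \<le> real (card (V - {v})) * real j"
    using sum_bounded_above[of "V - {v}" c "real j"] assms by auto
  also have "\<dots> \<le> real (card V) * real j"
    by (intro mult_right_mono) (use assms card_Diff1_le in auto)
  finally show ?thesis by simp
qed

text \<open>If \<open>x + y\<close> is poorly represented, then \<open>x\<close> and \<open>y\<close> cannot have large weights at two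
  different vertices, hence both are concentrated at one and the same vertex.\<close>
lemma few_reps_near_vertex:
  assumes V: "finite V" "V \<noteq> {}" and k: "k \<in> sumset (hull_points V n) (hull_points V n)"
    and r: "card (reps (hull_points V n) k) \<le> j"
  shows "\<exists>v\<in>V. k - int (2 * n) *s v \<in> int_box (2 * card V * j * spread V)"
proof -
  obtain x y b c where xy: "k = x + y" and c: "coords V n c x" and b: "coords V n b y"
    using k by (auto simp: sumset_def hull_points_def)
  have pos: "0 \<le> c u" "0 \<le> b u" if "u \<in> V" for u using b c that by (auto simp: coords_def)
  have excl: "u = v" if "u \<in> V" "v \<in> V" "real j \<le> c v" "real j \<le> b u" for u v
    using many_reps[OF V(1) that(1,2) _ c that(3) b that(4) finite_hull_points[OF V(1)]] r xy by fastforce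
  have "\<exists>v\<in>V. sum c (V - {v}) \<le> real (card V * j) \<and> sum b (V - {v}) \<le> real (card V * j)"
  \<comment> \<open>For small \<open>n\<close> every vertex works, the total weight being
    \<open>n\<close>. Otherwise, by pigeonhole, each point has weight at least \<open>j\<close> at
    some vertex, and \<open>excl\<close> makes the two vertices coincide.\<close>
  proof (cases "n < card V * j")
    case True
    obtain v where v: "v \<in> V" using V by blast
    have "sum c (V - {v}) \<le> real n" "sum b (V - {v}) \<le> real n"
      using b c pos[OF v] sum.remove[OF V(1) v, of c] sum.remove[OF V(1) v, of b] by (auto simp: coords_def)
    moreover have "real n \<le> real (card V * j)" using True by (simp del: of_nat_mult)
    ultimately show ?thesis using v by (intro bexI[of _ v]) linarith+
  next
    case False
    have ex: "\<exists>u\<in>V. real j \<le> a u" if a: "coords V n a t" for a t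
    proof (rule ccontr)
      assume "\<not> ?thesis"
      then have "sum a V < real (card V) * real j"
        using sum_strict_mono[OF V, of a "\<lambda>_. real j"] by (auto simp: not_le)
      then have "real n < real (card V * j)" using a by (simp add: coords_def)
      then show False using False by (simp del: of_nat_mult)
    qed
    obtain v where v: "v \<in> V" "real j \<le> c v" using ex[OF c] by blast
    obtain u where u: "u \<in> V" "real j \<le> b u" using ex[OF b] by blast
    have uv: "u = v" using excl[OF u(1) v(1) v(2) u(2)] .
    have "c t \<le> real j" if "t \<in> V - {v}" for t using excl[of u t] u that uv by fastforce
    moreover have "b t \<le> real j" if "t \<in> V - {v}" for t using excl[of t v] v that by fastforce
    ultimately show ?thesis using v sum_le_off_vertex[OF V(1) v(1)] by blast
  qed
  then obtain v where v: "v \<in> V" "sum c (V - {v}) \<le> real (card V * j)" "sum b (V - {v}) \<le> real (card V * j)"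
    by blast
  have "k - int (2 * n) *s v \<in> int_box ((2 * card V * j) * spread V)"
  proof (rule int_box_of_coeffs[OF V(1) v(1), of "\<lambda>u. c u + b u"])
    show "(\<Sum>u\<in>V - {v}. c u + b u) \<le> real (2 * card V * j)" using v by (simp add: sum.distrib)
    have "emb (k - int (2 * n) *s v) = (emb x - real n *\<^sub>R emb v) + (emb y - real n *\<^sub>R emb v)"
      by (simp add: xy emb_diff emb_add emb_smult vec_eq_iff)
    then show "emb (k - int (2 * n) *s v) = (\<Sum>u\<in>V. (c u + b u) *\<^sub>R (emb u - emb v))"
      by (simp add: coords_diff_vertex[OF b] coords_diff_vertex[OF c] scaleR_add_left sum.distrib)
  qed (use pos in auto)
  then show ?thesis using v(1) by auto
qed

text \<open>These sums lie in one box around each \<open>2 n v\<close>. The centres move with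
  \<open>n\<close> but the side length is linear in \<open>j\<close> alone, so the bound is uniform
  in \<open>n\<close>.\<close>

lemma few_reps_card:
  fixes V :: "(int ^ 'n) set"
  assumes V: "finite V" "V \<noteq> {}"
  shows "real (card {k \<in> sumset (hull_points V n) (hull_points V n). card (reps (hull_points V n) k) \<le> j})
     \<le> (real (card V) * (4 * real (card V) * real (spread V) + 1) ^ CARD('n)) * (real j + 1) ^ CARD('n)"
proof -
  let ?b = "2 * card V * j * spread V"
  let ?S = "{k \<in> sumset (hull_points V n) (hull_points V n). card (reps (hull_points V n) k) \<le> j}"
  have "?S \<subseteq> (\<Union>v\<in>V. (\<lambda>z. z + int (2 * n) *s v) ` int_box ?b)"
  proof
    fix k assume "k \<in> ?S"
    then obtain v where v: "v \<in> V" "k - int (2 * n) *s v \<in> int_box ?b"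
      using few_reps_near_vertex[OF V] by blast
    have "k = (k - int (2 * n) *s v) + int (2 * n) *s v" by simp
    then show "k \<in> (\<Union>v\<in>V. (\<lambda>z. z + int (2 * n) *s v) ` int_box ?b)" using v by blast
  qed
  then have "card ?S \<le> card (\<Union>v\<in>V. (\<lambda>z. z + int (2 * n) *s v) ` (int_box ?b :: (int ^ 'n) set))"
    by (rule card_mono[rotated]) (use V finite_int_box in auto)
  also have "\<dots> \<le> (\<Sum>v\<in>V. card ((\<lambda>z. z + int (2 * n) *s v) ` (int_box ?b :: (int ^ 'n) set)))"
    by (rule card_UN_le[OF V(1)])
  also have "\<dots> \<le> (\<Sum>v\<in>V. (2 * ?b + 1) ^ CARD('n))"
    by (intro sum_mono order_trans[OF card_image_le card_int_box] finite_int_box)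
  finally have "card ?S \<le> card V * (2 * ?b + 1) ^ CARD('n)" by simp
  then have "real (card ?S) \<le> real (card V * (2 * ?b + 1) ^ CARD('n))" by (simp only: of_nat_le_iff)
  also have "\<dots> = real (card V) * real (2 * ?b + 1) ^ CARD('n)" by simp
  also have "\<dots> \<le> real (card V) * ((4 * real (card V) * real (spread V) + 1) * (real j + 1)) ^ CARD('n)"
    by (intro mult_left_mono power_mono) (auto simp: algebra_simps)
  finally show ?thesis by (simp only: power_mult_distrib mult.assoc)
qed

section \<open>Heights above an exposed vertex\<close>

text \<open>An integer-valued inner product, so that heights are integers.\<close>

definition dotp :: "int ^ 'n \<Rightarrow> int ^ 'n \<Rightarrow> int" where
  "dotp g x = (\<Sum>i\<in>UNIV. g $ i * x $ i)"

lemma of_int_dotp: "real_of_int (dotp g x) = emb g \<bullet> emb x"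
  by (simp add: dotp_def inner_vec_def)

lemma dotp_add: "dotp g (x + y) = dotp g x + dotp g y"
  and dotp_diff: "dotp g (x - y) = dotp g x - dotp g y"
  and dotp_smult: "dotp g (k *s x) = k * dotp g x"
  and dotp_minus_left: "dotp (- g) x = - dotp g x"
  and dotp_commute: "dotp g x = dotp x g"
  by (simp_all add: dotp_def algebra_simps sum.distrib sum_subtractf sum_distrib_left sum_negf)

lemma dotp_self_pos: "x \<noteq> 0 \<Longrightarrow> dotp x x > 0"
proof -
  assume "x \<noteq> 0"
  then have "emb x \<noteq> 0" by (auto simp: vec_eq_iff)
  then have "real_of_int (dotp x x) > 0" by (simp only: of_int_dotp inner_gt_zero_iff) simp
  then show ?thesis by simp
qed

lemma dotp_square_diff: "dotp (a - b) (a - b) = dotp a a - 2 * dotp a b + dotp b b"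
proof -
  have "dotp (a - b) x = dotp a x - dotp b x" for x
    by (simp only: dotp_commute[of _ x] dotp_diff)
  then show ?thesis using dotp_commute[of b a] by (simp add: dotp_diff)
qed

text \<open>Used at both ends of a longest segment between vertices, once with \<open>g\<close> and
  once with \<open>- g\<close>. Integrality turns the strict inequality into a gap of at least
  1.\<close>

locale exposed_vertex =
  fixes V :: "(int ^ 'n) set" and v g :: "int ^ 'n"
  assumes finV: "finite V" and vV: "v \<in> V"
    and exposed: "\<And>u. u \<in> V \<Longrightarrow> u \<noteq> v \<Longrightarrow> dotp g v < dotp g u"
begin

definition ht :: "nat \<Rightarrow> int ^ 'n \<Rightarrow> int" where
  "ht n z = dotp g z - int n * dotp g v"

text \<open>Bounds the height lost by rounding down all coefficients off \<open>v\<close>; likewise,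
  coefficients of at most \<open>j\<close> give height at most \<open>j * total\<close>.\<close>

definition total :: int where
  "total = (\<Sum>u\<in>V. dotp g (u - v))"

lemma dotp_edge: "u \<in> V - {v} \<Longrightarrow> 1 \<le> dotp g (u - v)"
  using exposed[of u] by (simp add: dotp_diff)

lemma dotp_edge_nonneg: "u \<in> V \<Longrightarrow> 0 \<le> dotp g (u - v)"
  using dotp_edge[of u] by (cases "u = v") (auto simp: dotp_def[of g 0])

lemma total_nonneg: "0 \<le> total"
  unfolding total_def by (intro sum_nonneg dotp_edge_nonneg)

lemma ht_eq:
  assumes "emb z = real n *\<^sub>R emb v + (\<Sum>u\<in>V - {v}. c u *\<^sub>R (emb u - emb v))"
  shows "real_of_int (ht n z) = (\<Sum>u\<in>V - {v}. c u * real_of_int (dotp g (u - v)))"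
  unfolding ht_def using assms
  by (simp add: of_int_dotp emb_diff inner_sum_right inner_add_right)

text \<open>Every direction \<open>u - v\<close> has height at least 1, so the weight off
  \<open>v\<close> is at most the height of the point.\<close>

lemma coordsE:
  assumes "z \<in> hull_points V n"
  obtains c where "coords V n c z" "\<forall>u\<in>V - {v}. 0 \<le> c u"
    "c v = real n - sum c (V - {v})" "sum c (V - {v}) \<le> real n"
    "emb z = real n *\<^sub>R emb v + (\<Sum>u\<in>V - {v}. c u *\<^sub>R (emb u - emb v))"
    "sum c (V - {v}) \<le> real_of_int (ht n z)"
proof -
  obtain c where c: "coords V n c z" using assms by (auto simp: hull_points_def)
  have nn: "0 \<le> c u" if "u \<in> V" for u using c that by (auto simp: coords_def)
  have cv: "c v = real n - sum c (V - {v})"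
    using c sum.remove[OF finV vV, of c] by (simp add: coords_def)
  have e: "emb z = real n *\<^sub>R emb v + (\<Sum>u\<in>V - {v}. c u *\<^sub>R (emb u - emb v))"
    using coords_diff_vertex[OF c, of v] sum.remove[OF finV vV, of "\<lambda>u. c u *\<^sub>R (emb u - emb v)"]
    by (simp add: algebra_simps)
  have "sum c (V - {v}) \<le> (\<Sum>u\<in>V - {v}. c u * real_of_int (dotp g (u - v)))"
  proof (rule sum_mono)
    fix u assume u: "u \<in> V - {v}"
    have "1 \<le> real_of_int (dotp g (u - v))" using dotp_edge[OF u] by linarith
    then show "c u \<le> c u * real_of_int (dotp g (u - v))"
      using mult_left_mono[of 1 "real_of_int (dotp g (u - v))" "c u"] nn u by auto
  qed
  then show ?thesis using that[OF c _ cv _ e] nn cv nn[OF vV] ht_eq[OF e] by auto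
qed

lemma ht_nonneg: "z \<in> hull_points V n \<Longrightarrow> 0 \<le> ht n z"
proof (erule coordsE)
  fix c assume "\<forall>u\<in>V - {v}. 0 \<le> c u" "sum c (V - {v}) \<le> real_of_int (ht n z)"
  then show "0 \<le> ht n z" using sum_nonneg[of "V - {v}" c] by auto
qed

text \<open>Height 0 forces the weight off \<open>v\<close> to vanish, which leaves only the vertex
  itself.\<close>

lemma ht_pos: 
  assumes "z \<in> hull_points V n" "z \<noteq> int n *s v"
  shows "0 < ht n z"
proof (rule ccontr)
  assume "\<not> 0 < ht n z"
  with ht_nonneg[OF assms(1)] have 0: "ht n z = 0" by simp
  obtain c where c0: "coords V n c z" "\<forall>u\<in>V - {v}. 0 \<le> c u"
    "c v = real n - sum c (V - {v})" "sum c (V - {v}) \<le> real n"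
    "emb z = real n *\<^sub>R emb v + (\<Sum>u\<in>V - {v}. c u *\<^sub>R (emb u - emb v))"
    "sum c (V - {v}) \<le> real_of_int (ht n z)"
    by (rule coordsE[OF assms(1)])
  note c = c0(2)[rule_format] c0(6,5)
  have "sum c (V - {v}) = 0" using c(1,2) 0 sum_nonneg[of "V - {v}" c] by force
  then have "c u = 0" if "u \<in> V - {v}" for u
    using c(1) that finV sum_nonneg_eq_0_iff[of "V - {v}" c] by auto
  then have "emb z = emb (int n *s v)" using c(3) by (simp add: emb_smult)
  then show False using assms(2) by simp
qed

lemma vertex_in: "int n *s v \<in> hull_points V n"
  by (rule coordsI[OF finV vV, of "\<lambda>_. 0"]) (auto simp: emb_smult)

lemma edge_in:
  assumes "u \<in> V" "i \<le> n"
  shows "int n *s v + int i *s (u - v) \<in> hull_points V n"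
proof -
  have "coords V n (\<lambda>x. if x = v then real n else 0) (int n *s v)"
    using finV vV by (auto simp: coords_def emb_smult sum.delta if_distrib[of "\<lambda>a. a *\<^sub>R _"] cong: if_cong)
  from hull_points_shift[OF finV assms(1) vV this, of i] assms(2) show ?thesis by simp
qed

lemma ht_vertex [simp]: "ht n (int n *s v) = 0"
  by (simp add: ht_def dotp_smult)

lemma ht_sum: "ht n (x + y - int n *s v) = ht n x + ht n y"
  by (simp add: ht_def dotp_add dotp_diff dotp_smult)

text \<open>Height at most \<open>b\<close> means weight at most \<open>b\<close> off
  \<open>v\<close>, hence a place in a box around \<open>n v\<close> whose size is independent of
  \<open>n\<close>.\<close>

lemma card_low:
  "finite {z \<in> hull_points V n. ht n z \<le> int b}"
  "card {z \<in> hull_points V n. ht n z \<le> int b} \<le> card (int_box (b * spread V) :: (int ^ 'n) set)"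
proof -
  have sub: "{z \<in> hull_points V n. ht n z \<le> int b} \<subseteq> (\<lambda>z. z + int n *s v) ` int_box (b * spread V)"
  proof
    fix z assume z: "z \<in> {z \<in> hull_points V n. ht n z \<le> int b}"
    then have "z \<in> hull_points V n" by simp
    then obtain c where c0: "coords V n c z" "\<forall>u\<in>V - {v}. 0 \<le> c u"
    "c v = real n - sum c (V - {v})" "sum c (V - {v}) \<le> real n"
    "emb z = real n *\<^sub>R emb v + (\<Sum>u\<in>V - {v}. c u *\<^sub>R (emb u - emb v))"
    "sum c (V - {v}) \<le> real_of_int (ht n z)"
      by (rule coordsE)
    note c = c0(2)[rule_format] c0(6,5)
    have "z - int n *s v \<in> int_box (b * spread V)"
    proof (rule int_box_of_coeffs[OF finV vV, of c])
      show "sum c (V - {v}) \<le> real b" using c(2) z by (auto intro: order_trans)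
      show "emb (z - int n *s v) = (\<Sum>u\<in>V. c u *\<^sub>R (emb u - emb v))"
        using c(3) by (simp add: emb_diff emb_smult sum.remove[OF finV vV])
    qed (use c in auto)
    then show "z \<in> (\<lambda>z. z + int n *s v) ` int_box (b * spread V)"
      by (intro image_eqI[of _ _ "z - int n *s v"]) auto
  qed
  then show "finite {z \<in> hull_points V n. ht n z \<le> int b}"
    by (rule finite_subset) (simp add: finite_int_box)
  show "card {z \<in> hull_points V n. ht n z \<le> int b} \<le> card (int_box (b * spread V) :: (int ^ 'n) set)"
    using card_mono[OF _ sub] card_image_le[of "int_box (b * spread V)" "\<lambda>z. z + int n *s v"]
    by (meson finite_int_box finite_imageI le_trans)
qed

text \<open>Rounding down the coefficients of a real multiple \<open>\<theta>\<close> of \<open>z - n v\<close> splits the sum \<open>n v + z\<close>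
  at any prescribed height, up to a bounded error.\<close>
lemma split_at_height:
  assumes z: "z \<in> hull_points V n" and t: "0 \<le> t" "t \<le> real_of_int (ht n z)"
  obtains a b where "a \<in> hull_points V n" "b \<in> hull_points V n" "a + b = int n *s v + z"
    "t - real_of_int total \<le> real_of_int (ht n a)" "real_of_int (ht n a) \<le> t"
    "ht n a + ht n b = ht n z"
proof -
  obtain c where c0: "coords V n c z" "\<forall>u\<in>V - {v}. 0 \<le> c u"
    "c v = real n - sum c (V - {v})" "sum c (V - {v}) \<le> real n"
    "emb z = real n *\<^sub>R emb v + (\<Sum>u\<in>V - {v}. c u *\<^sub>R (emb u - emb v))"
    "sum c (V - {v}) \<le> real_of_int (ht n z)"
    by (rule coordsE[OF z])
  note c = c0(2)[rule_format] c0(4,5)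
  \<comment> \<open>If \<open>z\<close> has height 0, then \<open>t = 0\<close> and the quotient is
    0 by convention, which is the right value.\<close>
  define \<theta> where "\<theta> = t / real_of_int (ht n z)"
  have \<theta>: "0 \<le> \<theta>" "\<theta> \<le> 1" using t by (auto simp: \<theta>_def divide_le_eq_1)
  have \<theta>t: "\<theta> * real_of_int (ht n z) = t" using t by (auto simp: \<theta>_def)
  define f where "f u = \<lfloor>\<theta> * c u\<rfloor>" for u
  have f: "0 \<le> real_of_int (f u)" "real_of_int (f u) \<le> \<theta> * c u" "\<theta> * c u \<le> real_of_int (f u) + 1"
    "real_of_int (f u) \<le> c u" if "u \<in> V - {v}" for u
  proof -
    have "0 \<le> \<theta> * c u" using \<theta> c(1)[OF that] by simp
    then show "0 \<le> real_of_int (f u)" by (simp add: f_def)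
    show 1: "real_of_int (f u) \<le> \<theta> * c u" "\<theta> * c u \<le> real_of_int (f u) + 1" unfolding f_def by linarith+
    have "\<theta> * c u \<le> c u" using \<theta>(2) c(1)[OF that] by (simp add: mult_left_le_one_le \<theta>(1))
    then show "real_of_int (f u) \<le> c u" using 1 by linarith
  qed
  define a where "a = int n *s v + (\<Sum>u\<in>V - {v}. f u *s (u - v))"
  \<comment> \<open>This point carries the remaining coefficients \<open>c u - f u\<close>, which
    are nonnegative and have sum at most \<open>n\<close>.\<close>
  define b where "b = int n *s v + z - a"
  have ea: "emb a = real n *\<^sub>R emb v + (\<Sum>u\<in>V - {v}. real_of_int (f u) *\<^sub>R (emb u - emb v))"
    unfolding a_def emb_add emb_sum emb_smult emb_diff by simp
  have eb: "emb b = real n *\<^sub>R emb v + (\<Sum>u\<in>V - {v}. (c u - real_of_int (f u)) *\<^sub>R (emb u - emb v))"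
    unfolding b_def emb_diff emb_add ea c(3) emb_smult by (simp add: scaleR_diff_left sum_subtractf)
  have sf: "(\<Sum>u\<in>V - {v}. real_of_int (f u)) \<le> sum c (V - {v})" by (intro sum_mono f)
  have aL: "a \<in> hull_points V n"
    by (rule coordsI[OF finV vV _ _ ea]) (use f sf c in auto)
  have "(\<Sum>u\<in>V - {v}. c u - real_of_int (f u)) \<le> sum c (V - {v})" by (intro sum_mono) (use f in auto)
  then have bL: "b \<in> hull_points V n"
    by (intro coordsI[OF finV vV _ _ eb]) (use f c in auto)
  have d: "0 \<le> real_of_int (dotp g (u - v))" if "u \<in> V - {v}" for u using dotp_edge[OF that] by simp
  have tt: "t = (\<Sum>u\<in>V - {v}. \<theta> * c u * real_of_int (dotp g (u - v)))"
    using \<theta>t unfolding ht_eq[OF c(3)] by (simp add: sum_distrib_left mult.assoc)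
  have le: "real_of_int (ht n a) \<le> t"
    unfolding ht_eq[OF ea] tt by (intro sum_mono mult_right_mono f d)
  have "t \<le> (\<Sum>u\<in>V - {v}. (real_of_int (f u) + 1) * real_of_int (dotp g (u - v)))"
    unfolding tt by (intro sum_mono mult_right_mono f d)
  also have "\<dots> = real_of_int (ht n a) + real_of_int (\<Sum>u\<in>V - {v}. dotp g (u - v))"
    unfolding ht_eq[OF ea] by (simp add: distrib_right sum.distrib)
  also have "(\<Sum>u\<in>V - {v}. dotp g (u - v)) = total"
    unfolding total_def by (simp add: sum.remove[OF finV vV] dotp_def)
  finally have ge: "t - real_of_int total \<le> real_of_int (ht n a)" by simp
  have ab: "a + b = int n *s v + z" by (simp add: b_def)
  moreover have "ht n a + ht n b = ht n z"
    unfolding b_def ht_def by (simp add: dotp_add dotp_diff dotp_smult)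
  ultimately show ?thesis using that aL bL ge le by blast
qed

text \<open>As \<open>x\<close> is low and \<open>n\<close> large, \<open>x\<close> keeps weight at
  least \<open>j\<close> at \<open>v\<close>. A weight above \<open>j\<close> of \<open>y\<close> at
  another vertex would give more than \<open>j\<close> representations, so \<open>y\<close> is close
  to \<open>v\<close> as well and one summand can be replaced by \<open>n v\<close>.\<close>

lemma sum_via_vertex:
  assumes x: "x \<in> hull_points V n" "ht n x \<le> int b" and y: "y \<in> hull_points V n"
    and n: "b + card V * j \<le> n" and r: "card (reps (hull_points V n) (x + y)) \<le> j"
  shows "x + y - int n *s v \<in> hull_points V n" "ht n (x + y - int n *s v) \<le> int b + int j * total"
proof -
  obtain c where c0: "coords V n c x" "\<forall>u\<in>V - {v}. 0 \<le> c u"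
    "c v = real n - sum c (V - {v})" "sum c (V - {v}) \<le> real n"
    "emb x = real n *\<^sub>R emb v + (\<Sum>u\<in>V - {v}. c u *\<^sub>R (emb u - emb v))"
    "sum c (V - {v}) \<le> real_of_int (ht n x)"
    by (rule coordsE[OF x(1)])
  note c = c0(1) c0(2)[rule_format] c0(3,5,6)
  obtain e where e0: "coords V n e y" "\<forall>u\<in>V - {v}. 0 \<le> e u"
    "e v = real n - sum e (V - {v})" "sum e (V - {v}) \<le> real n"
    "emb y = real n *\<^sub>R emb v + (\<Sum>u\<in>V - {v}. e u *\<^sub>R (emb u - emb v))"
    "sum e (V - {v}) \<le> real_of_int (ht n y)"
    by (rule coordsE[OF y])
  note e = e0(1) e0(2)[rule_format] e0(5)
  have sc: "sum c (V - {v}) \<le> real b" using c(5) x(2) by linarith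
  have "card V \<ge> 1" using finV vV by (metis One_nat_def Suc_leI card_gt_0_iff empty_iff)
  then have "j \<le> card V * j" by simp
  then have "real b + real j \<le> real n" using n by linarith
  then have cv: "real j \<le> c v" using sc c(3) by linarith
  have ej: "e u \<le> real j" if u: "u \<in> V - {v}" for u
    using many_reps[OF finV _ vV _ c(1) cv e(1) _ finite_hull_points[OF finV], of u] u r by force
  have se: "sum e (V - {v}) \<le> real (card V * j)" by (rule sum_le_off_vertex[OF finV vV ej])
  have "(\<Sum>u\<in>V - {v}. c u + e u) \<le> real b + real (card V * j)" using sc se by (simp add: sum.distrib)
  also have "\<dots> \<le> real n" using n by (simp flip: of_nat_add of_nat_mult)
  finally show "x + y - int n *s v \<in> hull_points V n"
    by (intro coordsI[OF finV vV, of "\<lambda>u. c u + e u"])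
       (use c e in \<open>auto simp: emb_add emb_diff emb_smult scaleR_add_left sum.distrib\<close>)
  have "real_of_int (ht n y) \<le> (\<Sum>u\<in>V - {v}. real j * real_of_int (dotp g (u - v)))"
    unfolding ht_eq[OF e(3)]
  proof (intro sum_mono mult_right_mono ej)
    fix u assume "u \<in> V - {v}"
    then show "0 \<le> real_of_int (dotp g (u - v))" using dotp_edge[of u] by simp
  qed
  also have "\<dots> = real_of_int (int j * (\<Sum>u\<in>V - {v}. dotp g (u - v)))" by (simp add: sum_distrib_left)
  also have "(\<Sum>u\<in>V - {v}. dotp g (u - v)) = total"
    unfolding total_def by (simp add: sum.remove[OF finV vV] dotp_def)
  finally have "ht n y \<le> int j * total" by (simp only: of_int_le_iff)
  then show "ht n (x + y - int n *s v) \<le> int b + int j * total" using x(2) by (simp add: ht_sum)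
qed

end

section \<open>Removing few points\<close>

text \<open>A lowest remaining point is adjoined \<open>s\<close> times. Ties may be split, so
  closure is asked only for strictly smaller values.\<close>

lemma lower_set_of_card:
  fixes f :: "'a \<Rightarrow> int"
  assumes "finite S" "s \<le> card S"
  shows "\<exists>T\<subseteq>S. card T = s \<and> (\<forall>t\<in>T. \<forall>x\<in>S. f x < f t \<longrightarrow> x \<in> T)"
  using assms(2)
proof (induction s)
  case 0
  show ?case by (intro exI[of _ "{}"]) auto
next
  case (Suc s)
  then obtain T where T: "T \<subseteq> S" "card T = s" "\<forall>t\<in>T. \<forall>x\<in>S. f x < f t \<longrightarrow> x \<in> T" by auto
  have fT: "finite T" using T(1) assms(1) by (rule finite_subset)
  have "S - T \<noteq> {}" using T Suc.prems by auto
  then obtain x where x: "x \<in> S - T" "\<And>y. y \<in> S - T \<Longrightarrow> f x \<le> f y"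
    using ex_is_arg_min_if_finite[of "S - T" f] assms(1) by (auto simp: is_arg_min_linorder)
  show ?case
  proof (intro exI[of _ "insert x T"] conjI ballI impI)
    show "insert x T \<subseteq> S" using x T by auto
    show "card (insert x T) = Suc s" using x T fT by auto
    fix t y assume t: "t \<in> insert x T" and y: "y \<in> S" "f y < f t"
    show "y \<in> insert x T"
    proof (cases "t = x")
      case True
      then show ?thesis using y x(2)[of y] by auto
    next
      case False
      then show ?thesis using t y T(3) by auto
    qed
  qed
qed

text \<open>Missing differences come in pairs of opposite sign, whence the factor 2 in
  \<open>2 * d\<close>.\<close>

lemma diffset_uminus: "- z \<in> diffset X X \<longleftrightarrow> z \<in> diffset X X"
  unfolding diffset_def by (simp, metis minus_diff_eq minus_minus)

text \<open>The set \<open>T\<close> consists of the \<open>s\<close> lowest points other than \<open>n v\<close>, which destroy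
  exactly the \<open>s\<close> sums \<open>n v + t\<close>, and of two families of slabs of heights in \<open>X\<close> near \<open>n v\<close> and
  in \<open>Y\<close> near \<open>n w\<close>. These are chosen such that \<open>a + b \<in> [32 h, 33 h]\<close> with \<open>a, b \<ge> 0\<close> forces \<open>a \<in> X\<close> or
  \<open>b \<in> Y\<close>, which destroys differences, whereas every element of \<open>X\<close> is, with room to spare, a sum
  of two numbers in the complement of \<open>X\<close>, and likewise for \<open>Y\<close>; hence no further sums are lost.\<close>
lemma thinning:
  fixes v w g :: "int ^ 'n" and s d :: nat
  assumes "exposed_vertex V v g" "exposed_vertex V w (- g)" and g: "g = w - v" "v \<noteq> w"
  shows "\<exists>m N. \<forall>n\<ge>N. \<exists>T\<subseteq>hull_points V n. card T \<le> m \<and>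
     card (sumset (hull_points V n) (hull_points V n)
         - sumset (hull_points V n - T) (hull_points V n - T)) = s \<and>
     2 * d \<le> card (diffset (hull_points V n) (hull_points V n)
         - diffset (hull_points V n - T) (hull_points V n - T))"
proof -
  interpret A: exposed_vertex V v g by fact
  interpret B: exposed_vertex V w "- g" by fact
  define \<Lambda> where "\<Lambda> = dotp g g"
  have g0: "g \<noteq> 0" using g by simp
  have \<Lambda>: "\<Lambda> \<ge> 1" using dotp_self_pos[OF g0] by (simp add: \<Lambda>_def)
  have wv: "dotp g w = dotp g v + \<Lambda>" by (simp add: \<Lambda>_def g(1) dotp_diff)
  have BA: "B.ht n z = int n * \<Lambda> - A.ht n z" for n z
    unfolding A.ht_def B.ht_def dotp_minus_left wv by (simp add: algebra_simps)
  \<comment> \<open>One unit meets all constraints: with \<open>h = q * \<Lambda>\<close>, rounding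
    errors are at most \<open>h / 2\<close>, the heights in \<open>Ts\<close> stay below
    \<open>h / 2\<close>, and \<open>d\<close> consecutive multiples of \<open>g\<close> fit into a
    window of height \<open>h\<close>.\<close>
  define q where "q = 2 * A.total + 2 * B.total + int d + 2 * int s + 1"
  define h where "h = q * \<Lambda>"
  have q: "q \<ge> 1" "2 * A.total \<le> q" "2 * B.total \<le> q" "int d \<le> q" "2 * int s \<le> q - 1"
    using A.total_nonneg B.total_nonneg by (auto simp: q_def)
  have hq: "q \<le> h" using mult_left_mono[OF \<Lambda>, of q] q(1) by (simp add: h_def)
  have "2 * int s * \<Lambda> \<le> (q - 1) * \<Lambda>" using q(5) \<Lambda> by (intro mult_right_mono) auto
  then have sh: "2 * (int s * \<Lambda>) < h" 
    using \<Lambda> unfolding h_def left_diff_distrib by linarith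
  define m where "m = card (int_box (nat (33 * h) * spread V) :: (int ^ 'n) set)
     + card (int_box (nat (33 * h) * spread V) :: (int ^ 'n) set)"
  \<comment> \<open>\<open>100 * h\<close> keeps the two ends apart, the terms in \<open>m\<close>
    serve \<open>sum_via_vertex\<close> with \<open>j = 2 * m\<close>, and \<open>s\<close> makes
    room for \<open>s\<close> points on the segment from \<open>n v\<close> to
    \<open>n w\<close>.\<close>
  define N where "N = nat (100 * h) + nat (2 * int m * (A.total + B.total)) + card V * (2 * m) + s"
  have "\<exists>T\<subseteq>hull_points V n. card T \<le> m \<and>
     card (sumset (hull_points V n) (hull_points V n)
         - sumset (hull_points V n - T) (hull_points V n - T)) = s \<and>
     2 * d \<le> card (diffset (hull_points V n) (hull_points V n)
         - diffset (hull_points V n - T) (hull_points V n - T))" if n: "n \<ge> N" for n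
  proof -

    \<comment> \<open>The removed set\<close>
    define L where "L = hull_points V n"
    define o' where "o' = int n *s v"
    define p' where "p' = int n *s w"
    have finL: "finite L" unfolding L_def by (rule finite_hull_points[OF A.finV])
    have tot: "0 \<le> int m * A.total" "0 \<le> int m * B.total"
      using A.total_nonneg B.total_nonneg by auto
    have nN: "100 * h + 2 * (int m * A.total) + 2 * (int m * B.total) + int s \<le> int n"
      "nat (33 * h) + card V * (2 * m) \<le> n" "s \<le> n"
      using n hq q(1) tot by (auto simp: N_def algebra_simps)
    have n\<Lambda>: "int n \<le> int n * \<Lambda>" using mult_left_mono[OF \<Lambda>, of "int n"] by simp
    define X where "X t \<longleftrightarrow> (8 * h < t \<and> t < 12 * h) \<or> (20 * h < t \<and> t \<le> 33 * h)" for t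
    define Y where "Y t \<longleftrightarrow> (12 * h \<le> t \<and> t \<le> 21 * h) \<or> (24 * h \<le> t \<and> t \<le> 33 * h)" for t
    \<comment> \<open>Lattice points on the segment from \<open>n v\<close> to \<open>n w\<close>,
      at heights \<open>i * \<Lambda>\<close>; they guarantee enough low points for
      \<open>Ts\<close>.\<close>
    define e where "e i = o' + int i *s g" for i
    have eL: "e i \<in> L" if "i \<le> n" for i
      using A.edge_in[OF B.vV that] by (simp add: e_def o'_def L_def g(1))
    have hte: "A.ht n (e i) = int i * \<Lambda>" for i
      by (simp add: e_def o'_def A.ht_def dotp_add dotp_smult \<Lambda>_def)
    have inj_e: "inj_on e U" for U
      by (rule inj_onI) (use \<Lambda> hte in \<open>metis mult_cancel_right not_one_le_zero of_nat_eq_iff\<close>)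
    have e_sub: "e ` {1..s} \<subseteq> L - {o'}"
      using eL nN(3) g0 by (auto simp: e_def vec_eq_iff)
    have "card (e ` {1..s}) = s" by (simp add: card_image[OF inj_e])
    then have "s \<le> card (L - {o'})"
      using card_mono[OF _ e_sub] finL by simp
    then obtain Ts where Ts: "Ts \<subseteq> L - {o'}" "card Ts = s"
      "\<And>t x. t \<in> Ts \<Longrightarrow> x \<in> L - {o'} \<Longrightarrow> A.ht n x < A.ht n t \<Longrightarrow> x \<in> Ts"
      using lower_set_of_card[of "L - {o'}" s "A.ht n"] finL by blast
    have finTs: "finite Ts" using Ts(1) finL finite_subset by blast
    \<comment> \<open>A higher point in \<open>Ts\<close> would pull in all of
      \<open>e 1, ..., e s\<close> as strictly lower points, giving \<open>s + 1\<close>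
      elements.\<close>
    have Ts_ht: "A.ht n t \<le> int s * \<Lambda>" if t: "t \<in> Ts" for t
    proof (rule ccontr)
      assume big: "\<not> A.ht n t \<le> int s * \<Lambda>"
      have lt: "A.ht n (e i) < A.ht n t" if "i \<le> s" for i
        using big hte[of i] mult_right_mono[of "int i" "int s" \<Lambda>] that \<Lambda> by linarith
      have "e ` {1..s} \<subseteq> Ts" using Ts(3)[OF t] e_sub lt by (auto simp: image_subset_iff)
      moreover have "t \<notin> e ` {1..s}" by (auto dest!: lt)
      ultimately have "card (insert t (e ` {1..s})) \<le> card Ts"
        using t finTs by (intro card_mono) auto
      then show False
        using \<open>t \<notin> e ` {1..s}\<close> \<open>card (e ` {1..s}) = s\<close> Ts(2) by simp
    qed
    define T where "T = Ts \<union> {z \<in> L. X (A.ht n z)} \<union> {z \<in> L. Y (B.ht n z)}"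
    have TL: "T \<subseteq> L" using Ts(1) by (auto simp: T_def)
    have finT: "finite T" using TL finL by (rule finite_subset)
    have h0: "0 < h" "int (nat (33 * h)) = 33 * h" using hq q(1) by auto
    have T_ht: "A.ht n z \<le> 33 * h \<or> B.ht n z \<le> 33 * h" if "z \<in> T" for z
      using that Ts_ht[of z] sh h0 by (auto simp: T_def X_def Y_def)
    have "T \<subseteq> {z \<in> L. A.ht n z \<le> int (nat (33 * h))} \<union> {z \<in> L. B.ht n z \<le> int (nat (33 * h))}"
      using T_ht TL h0(2) by auto
    then have "card T \<le> card ({z \<in> L. A.ht n z \<le> int (nat (33 * h))} \<union> {z \<in> L. B.ht n z \<le> int (nat (33 * h))})"
      by (rule card_mono[rotated]) (use finL in auto)
    also have "\<dots> \<le> card {z \<in> L. A.ht n z \<le> int (nat (33 * h))} + card {z \<in> L. B.ht n z \<le> int (nat (33 * h))}"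
      by (rule card_Un_le)
    also have "\<dots> \<le> m"
      unfolding m_def L_def by (intro add_mono A.card_low B.card_low)
    finally have cT: "card T \<le> m" .
    \<comment> \<open>Below \<open>50 * h\<close> at the end of \<open>v\<close> the other end is
      out of reach of the slabs in \<open>Y\<close>, so only \<open>X\<close> and \<open>Ts\<close>
      matter.\<close>
    have notT_A: "z \<notin> T" if "\<not> X (A.ht n z)" "A.ht n z < 50 * h" "int s * \<Lambda> < A.ht n z" for z
    proof -
      have "\<not> Y (B.ht n z)" using that(2) nN(1) n\<Lambda> tot h0 unfolding Y_def BA by linarith
      then show ?thesis using that Ts_ht[of z] by (auto simp: T_def)
    qed
    have notT_B: "z \<notin> T" if "\<not> Y (B.ht n z)" "B.ht n z < 50 * h" for z
    proof -
      have big: "A.ht n z > 33 * h" using that(2) nN(1) n\<Lambda> tot h0 unfolding BA by linarith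
      then have "\<not> X (A.ht n z)" unfolding X_def using h0 by linarith
      moreover have "z \<notin> Ts" using Ts_ht[of z] big sh h0 by linarith
      ultimately show ?thesis using that by (auto simp: T_def)
    qed
    have oL: "o' \<in> L" "p' \<in> L" unfolding o'_def p'_def L_def by (rule A.vertex_in B.vertex_in)+
    have oT: "o' \<notin> T"
    proof -
      have "A.ht n o' = 0" by (simp add: o'_def)
      moreover from this have "\<not> Y (B.ht n o')" using nN(1) n\<Lambda> tot h0 unfolding Y_def BA by linarith
      ultimately show ?thesis using Ts(1) h0 by (auto simp: T_def X_def)
    qed
    have pT: "p' \<notin> T"
      by (rule notT_B) (use h0 in \<open>auto simp: p'_def Y_def\<close>)

    \<comment> \<open>The lost sums\<close>
    define M where "M = sumset L L - sumset (L - T) (L - T)"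
    have present: "a + b \<notin> M" if "a \<in> L - T" "b \<in> L - T" for a b
      using that by (auto simp: M_def sumset_def)
    have splitA: "o' + z \<notin> M" if z: "z \<in> L" "X (A.ht n z)" for z
    proof -
      let ?t = "real_of_int (A.ht n z)" let ?h = "real_of_int h"
      \<comment> \<open>Halving works for the lower slab and above \<open>26 * h\<close>. Between
        \<open>20 * h\<close> and \<open>26 * h\<close> the halves could fall into the lower slab,
        so there one part is taken just below \<open>7 * h\<close>.\<close>
      define t where "t = (if 20 * ?h < ?t \<and> ?t \<le> 26 * ?h then 7 * ?h else ?t / 2)"
      have t: "0 \<le> t" "t \<le> ?t" using z(2) h0 unfolding X_def t_def by auto
      obtain a b where ab: "a \<in> L" "b \<in> L" "a + b = o' + z"
        "t - real_of_int A.total \<le> real_of_int (A.ht n a)" "real_of_int (A.ht n a) \<le> t"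
        "A.ht n a + A.ht n b = A.ht n z"
        using A.split_at_height[OF z(1)[unfolded L_def] t] unfolding L_def o'_def by metis
      have tb: "real_of_int (A.ht n b) = ?t - real_of_int (A.ht n a)" using ab(6) by linarith
      have K: "2 * real_of_int A.total \<le> ?h" using q(2) hq by linarith
      have sh': "2 * real_of_int (int s * \<Lambda>) < ?h" using sh by linarith
      have X': "(8 * ?h < ?t \<and> ?t < 12 * ?h) \<or> (20 * ?h < ?t \<and> ?t \<le> 33 * ?h)"
        using z(2) unfolding X_def by linarith
      consider "8 * ?h < ?t" "?t < 12 * ?h" | "20 * ?h < ?t" "?t \<le> 26 * ?h" | "26 * ?h < ?t" "?t \<le> 33 * ?h"
        using X' by linarith
      then have "a \<notin> T \<and> b \<notin> T"
      proof cases
        case 1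
        then have "t = ?t / 2" using h0 by (auto simp: t_def)
        then have "?h < real_of_int (A.ht n a)" "real_of_int (A.ht n a) < 7 * ?h"
          "?h < real_of_int (A.ht n b)" "real_of_int (A.ht n b) < 7 * ?h"
          using 1 ab(4,5) tb K by linarith+
        then show ?thesis using sh' by (intro conjI notT_A; (unfold X_def)?; linarith)
      next
        case 2
        then have "t = 7 * ?h" by (auto simp: t_def)
        then have "6 * ?h < real_of_int (A.ht n a)" "real_of_int (A.ht n a) \<le> 7 * ?h"
          "13 * ?h \<le> real_of_int (A.ht n b)" "real_of_int (A.ht n b) \<le> 20 * ?h"
          using 2 ab(4,5) tb K h0 by linarith+
        then show ?thesis using sh' by (intro conjI notT_A; (unfold X_def)?; linarith)
      next
        case 3
        then have "t = ?t / 2" by (auto simp: t_def)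
        then have "12 * ?h < real_of_int (A.ht n a)" "real_of_int (A.ht n a) < 18 * ?h"
          "12 * ?h < real_of_int (A.ht n b)" "real_of_int (A.ht n b) < 18 * ?h"
          using 3 ab(4,5) tb K by linarith+
        then show ?thesis using sh' by (intro conjI notT_A; (unfold X_def)?; linarith)
      qed
      then show ?thesis using present[of a b] ab by auto
    qed
    have splitB: "p' + z \<notin> M" if z: "z \<in> L" "Y (B.ht n z)" for z
    proof -
      let ?t = "real_of_int (B.ht n z)" let ?h = "real_of_int h"
      \<comment> \<open>In the upper slab the second part is aimed at \<open>45 / 2 * h\<close>, the
        middle of the gap between the two slabs of \<open>Y\<close>; in the lower slab halving
        suffices.\<close>
      define t where "t = (if 24 * ?h \<le> ?t then ?t - 45 / 2 * ?h else ?t / 2)"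
      have t: "0 \<le> t" "t \<le> ?t" using z(2) h0 unfolding Y_def t_def by auto
      obtain a b where ab: "a \<in> L" "b \<in> L" "a + b = p' + z"
        "t - real_of_int B.total \<le> real_of_int (B.ht n a)" "real_of_int (B.ht n a) \<le> t"
        "B.ht n a + B.ht n b = B.ht n z"
        using B.split_at_height[OF z(1)[unfolded L_def] t] unfolding L_def p'_def by metis
      have tb: "real_of_int (B.ht n b) = ?t - real_of_int (B.ht n a)" using ab(6) by linarith
      have K: "2 * real_of_int B.total \<le> ?h" using q(3) hq by linarith
      have "(12 * ?h \<le> ?t \<and> ?t \<le> 21 * ?h) \<or> (24 * ?h \<le> ?t \<and> ?t \<le> 33 * ?h)"
        using z(2) unfolding Y_def by linarith
      then have "a \<notin> T \<and> b \<notin> T"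
      proof (elim disjE conjE)
        assume 1: "12 * ?h \<le> ?t" "?t \<le> 21 * ?h"
        then have "t = ?t / 2" using h0 by (auto simp: t_def)
        then have "real_of_int (B.ht n a) < 12 * ?h" "real_of_int (B.ht n b) < 12 * ?h"
          using 1 ab(4,5) tb K h0 by linarith+
        then show ?thesis using h0 by (intro conjI notT_B; (unfold Y_def)?; linarith)
      next
        assume 2: "24 * ?h \<le> ?t" "?t \<le> 33 * ?h"
        then have "t = ?t - 45 / 2 * ?h" by (auto simp: t_def)
        then have "real_of_int (B.ht n a) < 12 * ?h"
          "21 * ?h < real_of_int (B.ht n b)" "real_of_int (B.ht n b) < 24 * ?h"
          using 2 ab(4,5) tb K h0 by linarith+
        then show ?thesis using h0 by (intro conjI notT_B; (unfold Y_def)?; linarith)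
      qed
      then show ?thesis using present[of a b] ab by auto
    qed
    have few: "card (reps L k) \<le> 2 * m" if k: "k \<in> M" for k
    proof -
      have "x \<in> T \<or> k - x \<in> T" if "x \<in> reps L k" for x
        using present[of x "k - x"] k that by (auto simp: reps_def)
      then have "reps L k \<subseteq> T \<union> (\<lambda>x. k - x) ` T" 
        by (force simp: image_iff intro: bexI[of _ "k - _"])
      then have "card (reps L k) \<le> card (T \<union> (\<lambda>x. k - x) ` T)"
        by (rule card_mono[rotated]) (use finT in simp)
      also have "\<dots> \<le> card T + card ((\<lambda>x. k - x) ` T)" by (rule card_Un_le)
      also have "\<dots> \<le> 2 * m" using card_image_le[OF finT, of "\<lambda>x. k - x"] cT by linarith
      finally show ?thesis .
    qed
    \<comment> \<open>Since \<open>x\<close> is low at one end, the lost sum equals that end plus a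
      \<open>z\<close> low there. The end survives, so \<open>z \<in> T\<close>; the splittings
      exclude slabs, leaving \<open>z \<in> Ts\<close> at \<open>v\<close> and nothing at
      \<open>w\<close>.\<close>
    have key: "x + y \<in> (\<lambda>t. o' + t) ` Ts" if x: "x \<in> T" and y: "y \<in> L" and k: "x + y \<in> M" for x y
    proof -
      have r: "card (reps (hull_points V n) (x + y)) \<le> 2 * m" using few[OF k] by (simp add: L_def)
      have xL: "x \<in> hull_points V n" and yL: "y \<in> hull_points V n" using x y TL by (auto simp: L_def)
      show ?thesis
      proof (cases "A.ht n x \<le> 33 * h")
        case True
        define z where "z = x + y - o'"
        have z: "z \<in> L" "A.ht n z \<le> 33 * h + 2 * (int m * A.total)"
          using A.sum_via_vertex[OF xL _ yL nN(2) r] True h0(2) unfolding z_def o'_def L_def by auto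
        have xy: "x + y = o' + z" by (simp add: z_def)
        have "z \<in> T" using present[of o' z] k xy oL oT z(1) by auto
        moreover have "\<not> Y (B.ht n z)"
          using z(2) nN(1) n\<Lambda> tot h0 unfolding Y_def BA by linarith
        moreover have "\<not> X (A.ht n z)" using splitA[OF z(1)] k xy by auto
        ultimately show ?thesis using xy by (auto simp: T_def)
      next
        case False
        then have True: "B.ht n x \<le> 33 * h" using T_ht[OF x] by simp
        define z where "z = x + y - p'"
        have z: "z \<in> L" "B.ht n z \<le> 33 * h + 2 * (int m * B.total)"
          using B.sum_via_vertex[OF xL _ yL nN(2) r] True h0(2) unfolding z_def p'_def L_def by auto
        have xy: "x + y = p' + z" by (simp add: z_def)
        have "z \<in> T" using present[of p' z] k xy oL pT z(1) by auto
        moreover have big: "A.ht n z > 33 * h"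
          using z(2) nN(1) n\<Lambda> tot h0 unfolding BA by linarith
        moreover have "\<not> X (A.ht n z)" using big h0 unfolding X_def by linarith
        moreover have "z \<notin> Ts" using Ts_ht[of z] big sh h0 by linarith
        moreover have "\<not> Y (B.ht n z)" using splitB[OF z(1)] k xy by auto
        ultimately show ?thesis by (auto simp: T_def)
      qed
    qed
    have "M = (\<lambda>t. o' + t) ` Ts"
    proof
      show "M \<subseteq> (\<lambda>t. o' + t) ` Ts"
      proof
        fix k assume k: "k \<in> M"
        then obtain x y where xy: "k = x + y" "x \<in> L" "y \<in> L" by (auto simp: M_def sumset_def)
        then have "x \<in> T \<or> y \<in> T" using present[of x y] k by auto
        then show "k \<in> (\<lambda>t. o' + t) ` Ts"
          using key[of x y] key[of y x] xy k by (auto simp: add.commute)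
      qed
      show "(\<lambda>t. o' + t) ` Ts \<subseteq> M"
      proof
        fix k assume "k \<in> (\<lambda>t. o' + t) ` Ts"
        then obtain t where t: "t \<in> Ts" "k = o' + t" by auto
        have tL: "t \<in> L" using t(1) Ts(1) by auto
        \<comment> \<open>If one summand were \<open>o'\<close>, the other would be
          \<open>t \<in> T\<close>. Otherwise both have positive height, so \<open>x\<close> is
          strictly lower than \<open>t\<close> and hence in \<open>Ts\<close>.\<close>
        have "False" if xy: "k = x + y" "x \<in> L - T" "y \<in> L - T" for x y
        proof -
          have "t = x + y - o'" using xy(1) t(2) by (simp add: algebra_simps)
          then have ht: "A.ht n t = A.ht n x + A.ht n y" using A.ht_sum[of n x y] by (simp add: o'_def)
          have tT: "t \<in> T" using t(1) by (simp add: T_def)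
          have "x \<noteq> o'" "y \<noteq> o'" using xy t(2) tT by (auto simp: add.commute)
          then have "0 < A.ht n y" "x \<in> L - {o'}" using A.ht_pos[of y n] xy by (auto simp: L_def o'_def)
          then have "x \<in> Ts" using Ts(3)[OF t(1), of x] ht by auto
          then show False using xy by (auto simp: T_def)
        qed
        then have "k \<notin> sumset (L - T) (L - T)" unfolding sumset_def by blast
        moreover have "k \<in> sumset L L" using t tL oL by (auto simp: sumset_def)
        ultimately show "k \<in> M" by (simp add: M_def)
      qed
    qed
    then have cM: "card M = s" using Ts(2) by (simp add: card_image)

    \<comment> \<open>The lost differences\<close>
    define D where "D = {int n - 32 * q - int d<..int n - 32 * q}"
    have Dpos: "0 < k" "k \<le> int n" if "k \<in> D" for k
      using that nN(1) hq q tot by (auto simp: D_def)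
    have D_mem: "k *s g \<in> diffset L L - diffset (L - T) (L - T)" if k: "k \<in> D" for k
    proof -
      have "e (nat k) - o' = k *s g" using Dpos[OF k] by (simp add: e_def)
      moreover have "e (nat k) \<in> L" using eL[of "nat k"] Dpos[OF k] by linarith
      ultimately have "k *s g \<in> diffset L L" unfolding diffset_def using oL by (metis (mono_tags, lifting) mem_Collect_eq)
      moreover have "False" if xy: "k *s g = x - y" "x \<in> L - T" "y \<in> L - T" for x y
      proof -
        have "k * \<Lambda> = dotp g x - dotp g y"
          using arg_cong[OF xy(1), of "dotp g"] by (simp add: dotp_smult dotp_diff \<Lambda>_def)
        \<comment> \<open>From \<open>n v\<close> to \<open>n w\<close> the functional grows by
          \<open>n * \<Lambda>\<close>; the difference uses up \<open>k * \<Lambda>\<close>, and the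
          rest is shared by the heights of \<open>y\<close> and \<open>x\<close> above their
          ends.\<close>
        then have eq: "A.ht n y + B.ht n x = (int n - k) * \<Lambda>"
          unfolding BA by (simp add: A.ht_def algebra_simps)
        have "32 * q * \<Lambda> \<le> (int n - k) * \<Lambda>" "(int n - k) * \<Lambda> \<le> 33 * q * \<Lambda>"
          by (intro mult_right_mono; use k \<Lambda> q in \<open>auto simp: D_def\<close>)+
        then have bd: "32 * h \<le> A.ht n y + B.ht n x" "A.ht n y + B.ht n x \<le> 33 * h"
          unfolding eq h_def by (simp_all add: mult.assoc)
        have nn: "0 \<le> A.ht n y" "0 \<le> B.ht n x" using A.ht_nonneg B.ht_nonneg xy by (auto simp: L_def)
        have "\<not> X (A.ht n y)" "\<not> Y (B.ht n x)" using xy by (auto simp: T_def)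
        \<comment> \<open>In units of \<open>h\<close>, the first height lies in [0,8] or [12,20]
          and the second in [0,12) or (21,24), if neither exceeds 33. The possible sums fill [0,20),
          (21,32), [12,32) and (33,44), missing [32,33].\<close>
        then show False using bd nn unfolding X_def Y_def by linarith
      qed
      then have "k *s g \<notin> diffset (L - T) (L - T)" unfolding diffset_def by blast
      ultimately show ?thesis by simp
    qed
    have neg: "(- k) *s g = - (k *s g)" for k by (simp add: vec_eq_iff)
    have sub: "(\<lambda>k. k *s g) ` (D \<union> uminus ` D) \<subseteq> diffset L L - diffset (L - T) (L - T)"
      using D_mem by (auto simp: neg diffset_uminus)
    have "inj_on (\<lambda>k. k *s g) (D \<union> uminus ` D)"
      by (rule inj_onI) (use g0 in \<open>auto simp: vec_eq_iff\<close>)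
    then have "card ((\<lambda>k. k *s g) ` (D \<union> uminus ` D)) = card (D \<union> uminus ` D)" by (rule card_image)
    also have "\<dots> = card D + card (uminus ` D)"
    proof (rule card_Un_disjoint)
      have "- k \<notin> D" if "k \<in> D" for k using Dpos(1)[OF that] Dpos(1)[of "- k"] by linarith
      then show "D \<inter> uminus ` D = {}" by blast
    qed (simp_all add: D_def)
    also have "\<dots> = 2 * d" by (simp add: card_image D_def)
    finally have "2 * d = card ((\<lambda>k. k *s g) ` (D \<union> uminus ` D))" by simp
    also have "\<dots> \<le> card (diffset L L - diffset (L - T) (L - T))"
    proof (rule card_mono[OF _ sub])
      have "finite (diffset L L)" unfolding diffset_def by (rule finite_image_set2) (use finL in auto)
      then show "finite (diffset L L - diffset (L - T) (L - T))" by simp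
    qed
    finally show ?thesis using TL cT cM unfolding M_def L_def by blast
  qed
  then show ?thesis by blast
qed

text \<open>A pair of points at maximal distance is exposed by the functional given by its difference.\<close>
lemma exposed_pair:
  fixes V :: "(int ^ 'n) set"
  assumes V: "finite V" and ne: "x \<in> V" "y \<in> V" "x \<noteq> y"
  obtains v w where "v \<noteq> w" "exposed_vertex V v (w - v)" "exposed_vertex V w (- (w - v))"
proof -
  define f where "f p = dotp (snd p - fst p) (snd p - fst p)" for p :: "(int ^ 'n) \<times> (int ^ 'n)"
  have "finite (V \<times> V)" "V \<times> V \<noteq> {}" using V ne by auto
  then obtain p where "is_arg_min (\<lambda>r. - f r) (\<lambda>r. r \<in> V \<times> V) p"
    using ex_is_arg_min_if_finite[of "V \<times> V" "\<lambda>r. - f r"] by blast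
  then have p: "p \<in> V \<times> V" "\<And>r. r \<in> V \<times> V \<Longrightarrow> f r \<le> f p"
    unfolding is_arg_min_linorder neg_le_iff_le by blast+
  obtain v w where vw: "p = (v, w)" by (cases p)
  define g where "g = w - v"
  have VW: "v \<in> V" "w \<in> V" using p(1) vw by auto
  have max: "dotp (b - a) (b - a) \<le> dotp g g" if "a \<in> V" "b \<in> V" for a b
    using p(2)[of "(a, b)"] that by (simp add: vw f_def g_def)
  have "dotp g g > 0" using max[OF ne(1,2)] dotp_self_pos[of "y - x"] ne(3) by simp
  then have g0: "v \<noteq> w" by (auto simp: g_def dotp_def)
  have "dotp g v < dotp g u" if u: "u \<in> V" "u \<noteq> v" for u
  proof -
    have eq: "w - u = g - (u - v)" by (simp add: g_def)
    \<comment> \<open>Expanding the squared length of \<open>w - u\<close>, which is at most that of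
      \<open>g\<close>, bounds twice \<open>dotp g (u - v)\<close> below by the squared length of
      \<open>u - v\<close>.\<close>
    have "dotp g g - 2 * dotp g (u - v) + dotp (u - v) (u - v) \<le> dotp g g"
      using max[OF u(1) VW(2)] unfolding eq dotp_square_diff[of g "u - v"] .
    moreover have "dotp (u - v) (u - v) > 0" using dotp_self_pos[of "u - v"] u(2) by simp
    ultimately have "0 < dotp g (u - v)" by linarith
    then show ?thesis by (simp add: dotp_diff)
  qed
  moreover have "dotp (- g) w < dotp (- g) u" if u: "u \<in> V" "u \<noteq> w" for u
  proof -
    have eq: "u - v = g - (w - u)" by (simp add: g_def)
    have "dotp g g - 2 * dotp g (w - u) + dotp (w - u) (w - u) \<le> dotp g g"
      using max[OF VW(1) u(1)] unfolding eq dotp_square_diff[of g "w - u"] .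
    moreover have "dotp (w - u) (w - u) > 0" using dotp_self_pos[of "w - u"] u(2) by simp
    ultimately have "0 < dotp g (w - u)" by linarith
    then show ?thesis by (simp add: dotp_diff dotp_minus_left)
  qed
  ultimately show ?thesis
    using that[OF g0] V VW unfolding exposed_vertex_def g_def by blast
qed

theorem theorem2:
  fixes P :: "(real ^ 'n) set" and s d :: nat
  assumes "polytope P"
    and "\<forall>v. v extreme_point_of P \<longrightarrow> (\<forall>i. v $ i \<in> \<int>)"
    and "\<exists>x y. x \<in> P \<and> y \<in> P \<and> x \<noteq> y"
  shows "\<exists>c::real. c > 0 \<and>
    (\<forall>\<^sub>F n in sequentially.
       let L = lattice_points (dilate (real n) P) in
       real (card {A. A \<subseteq> L \<and>
                     card (sumset L L - sumset A A) = s \<and>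
                     card (diffset L L - diffset A A) \<ge> 2 * d})
         \<ge> c * 2 ^ card L)"
proof -
  define V :: "(int ^ 'n) set" where "V = {z. emb z extreme_point_of P}"
  have eV: "emb ` V = {x. x extreme_point_of P}"
  proof
    show "emb ` V \<subseteq> {x. x extreme_point_of P}" by (auto simp: V_def)
    show "{x. x extreme_point_of P} \<subseteq> emb ` V"
    proof
      fix x assume x: "x \<in> {x. x extreme_point_of P}"
      then obtain z where "emb z = x" using assms(2) integral_vec[of x] by auto
      then show "x \<in> emb ` V" using x by (auto simp: V_def)
    qed
  qed
  have finE: "finite {x. x extreme_point_of P}"
    using assms(1) by (intro finite_polyhedron_extreme_points polytope_imp_polyhedron)
  then have finV: "finite V" using eV inj_emb by (metis finite_imageD inj_on_subset subset_UNIV)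
  have P: "P = convex hull (emb ` V)"
    unfolding eV using assms(1) by (intro Krein_Milman_Minkowski polytope_imp_compact polytope_imp_convex)
  have "\<exists>x y. x \<in> V \<and> y \<in> V \<and> x \<noteq> y"
  proof (rule ccontr)
    assume "\<not> ?thesis"
    then have "V = {} \<or> (\<exists>a. V = {a})" by blast
    then have "P = {} \<or> (\<exists>a. P = {a})" unfolding P by auto
    then show False using assms(3) by auto
  qed
  then obtain x y where xy: "x \<in> V" "y \<in> V" "x \<noteq> y" by blast
  then have V0: "V \<noteq> {}" by blast
  obtain v w where vw: "v \<noteq> w" "exposed_vertex V v (w - v)" "exposed_vertex V w (- (w - v))"
    by (rule exposed_pair[OF finV xy])
  obtain m N where T: "\<And>n. n \<ge> N \<Longrightarrow> \<exists>T\<subseteq>hull_points V n. card T \<le> m \<and>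
     card (sumset (hull_points V n) (hull_points V n)
         - sumset (hull_points V n - T) (hull_points V n - T)) = s \<and>
     2 * d \<le> card (diffset (hull_points V n) (hull_points V n)
         - diffset (hull_points V n - T) (hull_points V n - T))"
    using thinning[OF vw(2,3) refl vw(1)] by blast
  define C where "C = real (card V) * (4 * real (card V) * real (spread V) + 1) ^ CARD('n)"
  have "C > 0" unfolding C_def using finV V0 by (intro mult_pos_pos zero_less_power) (auto simp: card_gt_0_iff intro: add_nonneg_pos)
  from positive_proportion_full_sumset[OF this, of "CARD('n)" m]
  obtain c where c: "c > 0" and main: "\<And>(L :: (int ^ 'n) set) T. finite L \<Longrightarrow>
      (\<forall>j. real (card {k \<in> sumset L L. card (reps L k) \<le> j}) \<le> C * (real j + 1) ^ CARD('n)) \<Longrightarrow>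
      T \<subseteq> L \<Longrightarrow> card T \<le> m \<Longrightarrow>
      c * 2 ^ card L \<le> real (card {A. A \<subseteq> L - T \<and> sumset A A = sumset (L - T) (L - T)})"
    by blast
  have "let L = lattice_points (dilate (real n) P) in
       real (card {A. A \<subseteq> L \<and> card (sumset L L - sumset A A) = s \<and>
                     card (diffset L L - diffset A A) \<ge> 2 * d}) \<ge> c * 2 ^ card L"
    if n: "n \<ge> N" "n > 0" for n
  proof -
    define L where "L = hull_points V n"
    have L: "lattice_points (dilate (real n) P) = L"
      unfolding L_def P by (rule lattice_points_dilate_hull[OF finV n(2)])
    have finL: "finite L" unfolding L_def by (rule finite_hull_points[OF finV])
    obtain T where T: "T \<subseteq> L" "card T \<le> m" "card (sumset L L - sumset (L - T) (L - T)) = s"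
       "2 * d \<le> card (diffset L L - diffset (L - T) (L - T))"
      using T[OF n(1)] unfolding L_def by blast
    have "c * 2 ^ card L \<le> real (card {A. A \<subseteq> L - T \<and> sumset A A = sumset (L - T) (L - T)})"
      by (rule main[OF finL _ T(1,2)]) (use few_reps_card[OF finV V0] in \<open>simp add: L_def C_def\<close>)
    also have "\<dots> \<le> real (card {A. A \<subseteq> L \<and> card (sumset L L - sumset A A) = s \<and>
                     card (diffset L L - diffset A A) \<ge> 2 * d})"
    proof (rule of_nat_mono, rule card_mono)
      show "finite {A. A \<subseteq> L \<and> card (sumset L L - sumset A A) = s \<and> 2 * d \<le> card (diffset L L - diffset A A)}"
        by (rule finite_subset[of _ "Pow L"]) (use finL in auto)
      have fin: "finite (diffset L L)" unfolding diffset_def by (rule finite_image_set2) (use finL in auto)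
      \<comment> \<open>A subset of \<open>L - T\<close> can only lose further differences, which is
        why they are bounded below while the sums are counted exactly.\<close>
      have "2 * d \<le> card (diffset L L - diffset A A)" if "A \<subseteq> L - T" for A
      proof -
        have "diffset A A \<subseteq> diffset (L - T) (L - T)" using that unfolding diffset_def by blast
        then have "card (diffset L L - diffset (L - T) (L - T)) \<le> card (diffset L L - diffset A A)"
          using fin by (intro card_mono) auto
        then show ?thesis using T(4) by linarith
      qed
      then show "{A. A \<subseteq> L - T \<and> sumset A A = sumset (L - T) (L - T)}
        \<subseteq> {A. A \<subseteq> L \<and> card (sumset L L - sumset A A) = s \<and> 2 * d \<le> card (diffset L L - diffset A A)}"
        using T(3) by auto
    qed
    finally show ?thesis unfolding L Let_def .
  qed
  then have "\<forall>\<^sub>F n in sequentially. let L = lattice_points (dilate (real n) P) in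
       real (card {A. A \<subseteq> L \<and> card (sumset L L - sumset A A) = s \<and>
                     card (diffset L L - diffset A A) \<ge> 2 * d}) \<ge> c * 2 ^ card L"
    \<comment> \<open>The successor also ensures \<open>n > 0\<close>, needed to rescale the
      hull.\<close>
    unfolding eventually_sequentially by (intro exI[of _ "Suc N"]) auto
  then show ?thesis using c by blast
qed

end
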